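(* There exist infinitely generated (i.e. not finitely generated) countable groups with metrizable space of ends, and there exist infinitely generated countable groups with non-metrizable space of ends. For instance: (a) the space of ends of a free group of infinite rank is non-metrizable (and actually such a group is not tamely-ended); (b) for every countable 1-ended group $H$, the space of ends of the free product $H\ast\mathbf{Z}$ is metrizable. For example, the space of ends of the free product $\mathbf{Q}\ast\mathbf{Z}$ is metrizable.
   Context: A subset $A$ of a group $G$ is left $G$-commensurated if $gA\bigtriangleup A$ is finite for every $g\in G$. These subsets form a Boolean subalgebra $\mathcal{P}_{(G)}(G)$ of the power set of $G$; $\mathcal{P}^\star_G(G)$ denotes its quotient by the ideal of finite subsets of $G$. The space of ends $\mathcal{E}^\star(G)$ is the Stone dual of $\mathcal{P}^\star_G(G)$, i.e. the compact Hausdorff totally disconnected space whose Boolean algebra of clopen subsets is $\mathcal{P}^\star_G(G)$. $G$ is 1-ended if $\mathcal{P}^\star_G(G)$ is reduced to $\mathbf{Z}/2\mathbf{Z}=\{0,1\}$ with $0\ne 1$; equivalently, $G$ is infinite and its only left $G$-commensurated subsets are the finite and the cofinite ones. For a set $I$, a function $f:G\to I$ is left $G$-almost invariant if for every $g\in G$ the set of $h\in G$ with $f(gh)\neq f(h)$ is finite. $G$ is tamely-ended if every left $G$-almost invariant function on $G$ (to any set) has finite image. *)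

theory Defs
  imports "HOL-Analysis.Analysis" "HOL-Algebra.Algebra"
begin

section \<open>Commensurated subsets and the space of ends\<close>

definition left_commensurated :: "('a, 'm) monoid_scheme \<Rightarrow> 'a set \<Rightarrow> bool" where
  "left_commensurated G A \<longleftrightarrow>
     A \<subseteq> carrier G \<and> (\<forall>g\<in>carrier G. finite (sym_diff (g <#\<^bsub>G\<^esub> A) A))"

text \<open>Boolean algebras are treated as Boolean rings: symmetric difference is addition and
  intersection is multiplication.\<close>

definition commensurated_algebra :: "('a, 'm) monoid_scheme \<Rightarrow> 'a set ring" where
  "commensurated_algebra G =
     \<lparr>carrier = {A. left_commensurated G A}, monoid.mult = (\<inter>), one = carrier G,
      ring.zero = {}, ring.add = (\<lambda>A B. sym_diff A B)\<rparr>"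

definition finite_subsets :: "('a, 'm) monoid_scheme \<Rightarrow> 'a set set" where
  "finite_subsets G = {A. A \<subseteq> carrier G \<and> finite A}"

definition ends_algebra :: "('a, 'm) monoid_scheme \<Rightarrow> 'a set set ring" where
  "ends_algebra G = commensurated_algebra G Quot finite_subsets G"

text \<open>The Stone dual of a Boolean ring is its prime spectrum. The prime ideals are exactly the
  complements of the ultrafilters, and the basic open sets below are exactly the clopen sets,
  forming a Boolean algebra isomorphic to the given one.\<close>

definition stone_dual :: "('a, 'm) ring_scheme \<Rightarrow> 'a set topology" where
  "stone_dual A = topology_generated_by {{P. primeideal P A \<and> a \<notin> P} | a. a \<in> carrier A}"

definition space_of_ends :: "('a, 'm) monoid_scheme \<Rightarrow> 'a set set set topology" where
  "space_of_ends G = stone_dual (ends_algebra G)"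

definition one_ended :: "('a, 'm) monoid_scheme \<Rightarrow> bool" where
  "one_ended G \<longleftrightarrow>
     carrier (ends_algebra G) = {\<zero>\<^bsub>ends_algebra G\<^esub>, \<one>\<^bsub>ends_algebra G\<^esub>} \<and>
     \<zero>\<^bsub>ends_algebra G\<^esub> \<noteq> \<one>\<^bsub>ends_algebra G\<^esub>"

definition left_almost_invariant :: "('a, 'm) monoid_scheme \<Rightarrow> ('a \<Rightarrow> 'i) \<Rightarrow> bool" where
  "left_almost_invariant G f \<longleftrightarrow>
     (\<forall>g\<in>carrier G. finite {h \<in> carrier G. f (g \<otimes>\<^bsub>G\<^esub> h) \<noteq> f h})"

text \<open>A definition cannot quantify over the type of values of \<open>f\<close>. Taking values in the
  element type of \<open>G\<close> loses nothing; see \<open>tamely_endedD\<close> below.\<close>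

definition tamely_ended :: "('a, 'm) monoid_scheme \<Rightarrow> bool" where
  "tamely_ended G \<longleftrightarrow>
     (\<forall>f::'a \<Rightarrow> 'a. left_almost_invariant G f \<longrightarrow> finite (f ` carrier G))"

lemma tamely_endedD:
  fixes f :: "'a \<Rightarrow> 'i"
  assumes "group G" "tamely_ended G" "left_almost_invariant G f"
  shows "finite (f ` carrier G)"
proof -
  interpret group G by fact
  define r where "r = inv_into (carrier G) f"
  have r: "f (r (f h)) = f h" if "h \<in> carrier G" for h
    using that by (auto simp: r_def intro: f_inv_into_f)
  have "left_almost_invariant G (r \<circ> f)"
    unfolding left_almost_invariant_def
  proof
    fix g assume g: "g \<in> carrier G"
    have "{h \<in> carrier G. (r \<circ> f) (g \<otimes>\<^bsub>G\<^esub> h) \<noteq> (r \<circ> f) h}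
            \<subseteq> {h \<in> carrier G. f (g \<otimes>\<^bsub>G\<^esub> h) \<noteq> f h}"
      by auto
    thus "finite {h \<in> carrier G. (r \<circ> f) (g \<otimes>\<^bsub>G\<^esub> h) \<noteq> (r \<circ> f) h}"
      using assms(3) g unfolding left_almost_invariant_def by (metis (no_types, lifting) finite_subset)
  qed
  hence "finite ((r \<circ> f) ` carrier G)"
    using assms(2) unfolding tamely_ended_def by blast
  hence "finite (f ` (r \<circ> f) ` carrier G)"
    by (rule finite_imageI)
  moreover have "f ` (r \<circ> f) ` carrier G = f ` carrier G"
    by (auto simp: image_image r)
  ultimately show ?thesis by simp
qed

context group
begin

lemma l_coset_Int:
  assumes "g \<in> carrier G" "A \<subseteq> carrier G" "B \<subseteq> carrier G"
  shows "g <# (A \<inter> B) = (g <# A) \<inter> (g <# B)"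
proof -
  have "inj_on (\<lambda>x. g \<otimes> x) (carrier G)" using assms(1) by (simp add: inj_on_multc inj_on_cmult)
  hence "(\<lambda>x. g \<otimes> x) ` (A \<inter> B) = (\<lambda>x. g \<otimes> x) ` A \<inter> (\<lambda>x. g \<otimes> x) ` B"
    using assms by (intro inj_on_image_Int)
  thus ?thesis by (auto simp: l_coset_def)
qed

lemma l_coset_sym_diff:
  assumes "g \<in> carrier G" "A \<subseteq> carrier G" "B \<subseteq> carrier G"
  shows "g <# sym_diff A B = sym_diff (g <# A) (g <# B)"
proof -
  have inj: "inj_on (\<lambda>x. g \<otimes> x) (carrier G)" using assms(1) by (simp add: inj_on_cmult)
  have "(\<lambda>x. g \<otimes> x) ` (A - B) = (\<lambda>x. g \<otimes> x) ` A - (\<lambda>x. g \<otimes> x) ` B"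
    by (rule inj_on_image_set_diff[OF inj]) (use assms in auto)
  moreover have "(\<lambda>x. g \<otimes> x) ` (B - A) = (\<lambda>x. g \<otimes> x) ` B - (\<lambda>x. g \<otimes> x) ` A"
    by (rule inj_on_image_set_diff[OF inj]) (use assms in auto)
  moreover have "g <# C = (\<lambda>x. g \<otimes> x) ` C" for C by (auto simp: l_coset_def)
  ultimately show ?thesis by (simp add: image_Un)
qed

lemma left_commensurated_carrier: "left_commensurated G (carrier G)"
  unfolding left_commensurated_def by (auto simp: coset_join3 subgroup_self)

lemma left_commensurated_finite:
  assumes "A \<subseteq> carrier G" "finite A" shows "left_commensurated G A"
  using assms unfolding left_commensurated_def by (auto simp: l_coset_def)

lemma left_commensurated_Int:
  assumes "left_commensurated G A" "left_commensurated G B"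
  shows "left_commensurated G (A \<inter> B)"
  unfolding left_commensurated_def
proof (intro conjI ballI)
  have sub: "A \<subseteq> carrier G" "B \<subseteq> carrier G" using assms by (auto simp: left_commensurated_def)
  thus "A \<inter> B \<subseteq> carrier G" by auto
  fix g assume g: "g \<in> carrier G"
  have "sym_diff (g <# (A \<inter> B)) (A \<inter> B) \<subseteq> sym_diff (g <# A) A \<union> sym_diff (g <# B) B"
    unfolding l_coset_Int[OF g sub] by blast
  thus "finite (sym_diff (g <# (A \<inter> B)) (A \<inter> B))"
    using assms g by (meson finite_UnI finite_subset left_commensurated_def)
qed

lemma left_commensurated_sym_diff:
  assumes "left_commensurated G A" "left_commensurated G B"
  shows "left_commensurated G (sym_diff A B)"
  unfolding left_commensurated_def
proof (intro conjI ballI)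
  have sub: "A \<subseteq> carrier G" "B \<subseteq> carrier G" using assms by (auto simp: left_commensurated_def)
  thus "sym_diff A B \<subseteq> carrier G" by auto
  fix g assume g: "g \<in> carrier G"
  have "sym_diff (g <# sym_diff A B) (sym_diff A B) \<subseteq> sym_diff (g <# A) A \<union> sym_diff (g <# B) B"
    unfolding l_coset_sym_diff[OF g sub] by blast
  thus "finite (sym_diff (g <# sym_diff A B) (sym_diff A B))"
    using assms g by (meson finite_UnI finite_subset left_commensurated_def)
qed

lemma cring_commensurated_algebra: "cring (commensurated_algebra G)"
proof (rule cringI)
  show "abelian_group (commensurated_algebra G)"
  proof (rule abelian_groupI)
    fix A assume "A \<in> carrier (commensurated_algebra G)"
    thus "\<exists>B\<in>carrier (commensurated_algebra G).
            B \<oplus>\<^bsub>commensurated_algebra G\<^esub> A = \<zero>\<^bsub>commensurated_algebra G\<^esub>"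
      by (intro bexI[of _ A]) (auto simp: commensurated_algebra_def)
  qed (auto simp: commensurated_algebra_def left_commensurated_sym_diff left_commensurated_finite)
  show "comm_monoid (commensurated_algebra G)"
    by (rule comm_monoidI)
      (auto simp: commensurated_algebra_def left_commensurated_Int left_commensurated_carrier,
       auto simp: left_commensurated_def)
qed (auto simp: commensurated_algebra_def)

lemma ideal_finite_subsets: "ideal (finite_subsets G) (commensurated_algebra G)"
proof -
  interpret R: cring "commensurated_algebra G" by (rule cring_commensurated_algebra)
  have minus: "\<ominus>\<^bsub>commensurated_algebra G\<^esub> A = A" if "left_commensurated G A" for A
    by (rule R.minus_equality) (use that in \<open>auto simp: commensurated_algebra_def\<close>)
  show ?thesis
  proof (rule idealI)
    show "ring (commensurated_algebra G)" by (rule R.ring_axioms)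
    show "subgroup (finite_subsets G) (add_monoid (commensurated_algebra G))"
    proof (rule R.add.subgroupI)
      fix A assume A: "A \<in> finite_subsets G"
      hence "left_commensurated G A" by (simp add: finite_subsets_def left_commensurated_finite)
      thus "\<ominus>\<^bsub>commensurated_algebra G\<^esub> A \<in> finite_subsets G" using A by (simp add: minus)
    qed (auto simp: finite_subsets_def commensurated_algebra_def left_commensurated_finite)
  qed (auto simp: finite_subsets_def commensurated_algebra_def)
qed

lemma cring_ends_algebra: "cring (ends_algebra G)"
  unfolding ends_algebra_def
  by (rule ideal.quotient_is_cring[OF ideal_finite_subsets cring_commensurated_algebra])

end


section \<open>Free groups and free products\<close>

text \<open>Elements are reduced words. The product lets the letters of the first word act on the
  second one by prepending a letter and then reducing. The letters \<open>(s, True)\<close> and \<open>(s, False)\<close>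
  stand for \<open>s\<close> and its inverse.\<close>

definition free_cons :: "'a \<times> bool \<Rightarrow> ('a \<times> bool) list \<Rightarrow> ('a \<times> bool) list" where
  "free_cons x w = (case w of [] \<Rightarrow> [x]
     | y # ys \<Rightarrow> (if y = (fst x, \<not> snd x) then ys else x # w))"

definition free_group :: "'a set \<Rightarrow> ('a \<times> bool) list monoid" where
  "free_group S =
     \<lparr>carrier = {w. set w \<subseteq> S \<times> UNIV \<and> successively (\<lambda>x y. y \<noteq> (fst x, \<not> snd x)) w},
      mult = (\<lambda>u v. foldr free_cons u v), one = []\<rparr>"

definition product_cons ::
  "('a, 'm) monoid_scheme \<Rightarrow> ('b, 'n) monoid_scheme \<Rightarrow> 'a + 'b \<Rightarrow> ('a + 'b) list \<Rightarrow> ('a + 'b) list"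
where
  "product_cons G H x w = (case x of
     Inl a \<Rightarrow> (if a = \<one>\<^bsub>G\<^esub> then w else case w of
        Inl b # ys \<Rightarrow> (if a \<otimes>\<^bsub>G\<^esub> b = \<one>\<^bsub>G\<^esub> then ys else Inl (a \<otimes>\<^bsub>G\<^esub> b) # ys)
      | _ \<Rightarrow> x # w)
   | Inr a \<Rightarrow> (if a = \<one>\<^bsub>H\<^esub> then w else case w of
        Inr b # ys \<Rightarrow> (if a \<otimes>\<^bsub>H\<^esub> b = \<one>\<^bsub>H\<^esub> then ys else Inr (a \<otimes>\<^bsub>H\<^esub> b) # ys)
      | _ \<Rightarrow> x # w))"

definition free_product ::
  "('a, 'm) monoid_scheme \<Rightarrow> ('b, 'n) monoid_scheme \<Rightarrow> ('a + 'b) list monoid" where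
  "free_product G H =
     \<lparr>carrier = {w. set w \<subseteq> (carrier G - {\<one>\<^bsub>G\<^esub>}) <+> (carrier H - {\<one>\<^bsub>H\<^esub>}) \<and>
                    successively (\<lambda>x y. isl x \<noteq> isl y) w},
      mult = (\<lambda>u v. foldr (product_cons G H) u v), one = []\<rparr>"

lemma group_free_group: "group (free_group S)"
proof -
  let ?C = "carrier (free_group S)"
  have Cons: "w \<in> ?C" if "x # w \<in> ?C" for x w
    using that by (cases w) (auto simp: free_group_def)
  have cons_closed: "free_cons x w \<in> ?C" if "fst x \<in> S" "w \<in> ?C" for x w
    using that by (cases x; cases w; cases "tl w")
      (auto simp: free_group_def free_cons_def split: if_splits)
  have foldr_closed: "foldr free_cons u v \<in> ?C" if "set u \<subseteq> S \<times> UNIV" "v \<in> ?C" for u v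
    using that by (induction u) (auto intro!: cons_closed)
  have cancel: "free_cons x (free_cons (fst x, \<not> snd x) w) = w" if "w \<in> ?C" for x w
    using that by (cases x; cases w; cases "tl w")
      (auto simp: free_group_def free_cons_def split: if_splits)
  have assoc1: "foldr free_cons (free_cons x u) v = free_cons x (foldr free_cons u v)"
    if "fst x \<in> S" "u \<in> ?C" "v \<in> ?C" for x u v
  proof (cases u)
    case (Cons y ys)
    show ?thesis
    proof (cases "y = (fst x, \<not> snd x)")
      case True
      have "set ys \<subseteq> S \<times> UNIV" using that(2) Cons by (auto simp: free_group_def)
      hence "foldr free_cons ys v \<in> ?C" using that(3) by (rule foldr_closed)
      moreover have "free_cons x u = ys" using True Cons by (simp add: free_cons_def)
      ultimately show ?thesis using True Cons cancel by simp
    qed (simp add: Cons free_cons_def[of x "y # ys"])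
  qed (simp add: free_cons_def)
  have assoc: "foldr free_cons (foldr free_cons u v) w = foldr free_cons u (foldr free_cons v w)"
    if "set u \<subseteq> S \<times> UNIV" "v \<in> ?C" "w \<in> ?C" for u v w
    using that by (induction u) (auto simp: assoc1 foldr_closed)
  have unit: "foldr free_cons u [] = u" if "u \<in> ?C" for u
    using that
  proof (induction u)
    case (Cons x u)
    thus ?case using \<open>\<And>x w. x # w \<in> ?C \<Longrightarrow> w \<in> ?C\<close>[OF Cons.prems]
      by (cases u) (auto simp: free_group_def free_cons_def)
  qed simp
  have inverse: "\<exists>v\<in>?C. foldr free_cons v u = []" if "u \<in> ?C" for u
    using that
  proof (induction u)
    case Nil
    show ?case by (intro bexI[of _ "[]"]) (auto simp: free_group_def)
  next
    case (Cons x u)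
    have u: "u \<in> ?C" using \<open>\<And>x w. x # w \<in> ?C \<Longrightarrow> w \<in> ?C\<close>[OF Cons.prems] .
    then obtain v where v: "v \<in> ?C" "foldr free_cons v u = []" using Cons.IH by blast
    let ?y = "(fst x, \<not> snd x)"
    have x: "fst x \<in> S" using Cons.prems by (auto simp: free_group_def)
    have y: "[?y] \<in> ?C" using x by (auto simp: free_group_def)
    have vS: "set v \<subseteq> S \<times> UNIV" using v by (auto simp: free_group_def)
    have "foldr free_cons (foldr free_cons v [?y]) (x # u) = foldr free_cons v (foldr free_cons [?y] (x # u))"
      by (rule assoc[OF vS y Cons.prems])
    also have "foldr free_cons [?y] (x # u) = u" by (simp add: free_cons_def)
    finally have "foldr free_cons (foldr free_cons v [?y]) (x # u) = []" using v by simp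
    thus ?case using foldr_closed[OF vS y] by blast
  qed
  have sub: "set u \<subseteq> S \<times> UNIV" if "u \<in> ?C" for u using that by (auto simp: free_group_def)
  have ops: "u \<otimes>\<^bsub>free_group S\<^esub> v = foldr free_cons u v" "\<one>\<^bsub>free_group S\<^esub> = []" for u v
    by (simp_all add: free_group_def)
  show ?thesis
  proof (rule groupI, unfold ops)
    show "[] \<in> ?C" by (simp add: free_group_def)
  qed (use assoc foldr_closed sub inverse in \<open>auto\<close>)
qed

lemma group_free_product:
  assumes "group G" "group H"
  shows "group (free_product G H)"
proof -
  interpret G: group G by fact
  interpret H: group H by fact
  let ?C = "carrier (free_product G H)"
  let ?L = "carrier G <+> carrier H"
  let ?c = "product_cons G H"
  have Cons: "w \<in> ?C" if "x # w \<in> ?C" for x w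
    using that by (cases w) (auto simp: free_product_def)
  have cons_closed: "?c x w \<in> ?C" if "x \<in> ?L" "w \<in> ?C" for x w
    using that by (cases x; cases w; cases "hd w"; cases "tl w"; cases "hd (tl w)")
      (auto simp: free_product_def product_cons_def split: if_splits)
  have foldr_closed: "foldr ?c u v \<in> ?C" if "set u \<subseteq> ?L" "v \<in> ?C" for u v
    using that by (induction u) (auto intro!: cons_closed)
  have merge_l: "?c (Inl a) (?c (Inl b) w) = ?c (Inl (a \<otimes>\<^bsub>G\<^esub> b)) w"
    if w: "w \<in> ?C" and a: "a \<in> carrier G" and b: "b \<in> carrier G" for a b w
  proof (cases "\<exists>d ys. w = Inl d # ys")
    case False
    have *: "?c (Inl e) w = (if e = \<one>\<^bsub>G\<^esub> then w else Inl e # w)" for e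
      using False by (auto simp: product_cons_def split: list.splits sum.splits)
    have **: "?c (Inl e) (Inl f # w) = (if e \<otimes>\<^bsub>G\<^esub> f = \<one>\<^bsub>G\<^esub> then w else Inl (e \<otimes>\<^bsub>G\<^esub> f) # w)"
      if "e \<in> carrier G" "f \<in> carrier G" "f \<noteq> \<one>\<^bsub>G\<^esub>" for e f
      using that by (auto simp: product_cons_def)
    show ?thesis using a b by (auto simp: * **)
  next
    case True
    then obtain d ys where wd: "w = Inl d # ys" by blast
    have d: "d \<in> carrier G" "d \<noteq> \<one>\<^bsub>G\<^esub>" using w wd by (auto simp: free_product_def)
    have ys: "\<not> (\<exists>d zs. ys = Inl d # zs)" using w wd by (auto simp: free_product_def)
    have 1: "?c (Inl e) w = (if e \<otimes>\<^bsub>G\<^esub> d = \<one>\<^bsub>G\<^esub> then ys else Inl (e \<otimes>\<^bsub>G\<^esub> d) # ys)"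
      if "e \<in> carrier G" for e
      using that d by (auto simp: product_cons_def wd)
    have 2: "?c (Inl e) ys = (if e = \<one>\<^bsub>G\<^esub> then ys else Inl e # ys)" for e
      using ys by (auto simp: product_cons_def split: list.splits sum.splits)
    have 3: "?c (Inl e) (Inl f # ys) = (if e \<otimes>\<^bsub>G\<^esub> f = \<one>\<^bsub>G\<^esub> then ys else Inl (e \<otimes>\<^bsub>G\<^esub> f) # ys)"
      if "e \<in> carrier G" "f \<in> carrier G" "f \<noteq> \<one>\<^bsub>G\<^esub>" for e f
      using that by (auto simp: product_cons_def)
    show ?thesis using a b d by (auto simp: 1 2 3 G.m_assoc)
  qed
  have merge_r: "?c (Inr a) (?c (Inr b) w) = ?c (Inr (a \<otimes>\<^bsub>H\<^esub> b)) w"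
    if w: "w \<in> ?C" and a: "a \<in> carrier H" and b: "b \<in> carrier H" for a b w
  proof (cases "\<exists>d ys. w = Inr d # ys")
    case False
    have *: "?c (Inr e) w = (if e = \<one>\<^bsub>H\<^esub> then w else Inr e # w)" for e
      using False by (auto simp: product_cons_def split: list.splits sum.splits)
    have **: "?c (Inr e) (Inr f # w) = (if e \<otimes>\<^bsub>H\<^esub> f = \<one>\<^bsub>H\<^esub> then w else Inr (e \<otimes>\<^bsub>H\<^esub> f) # w)"
      if "e \<in> carrier H" "f \<in> carrier H" "f \<noteq> \<one>\<^bsub>H\<^esub>" for e f
      using that by (auto simp: product_cons_def)
    show ?thesis using a b by (auto simp: * **)
  next
    case True
    then obtain d ys where wd: "w = Inr d # ys" by blast
    have d: "d \<in> carrier H" "d \<noteq> \<one>\<^bsub>H\<^esub>" using w wd by (auto simp: free_product_def)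
    have ys: "\<not> (\<exists>d zs. ys = Inr d # zs)" using w wd by (auto simp: free_product_def)
    have 1: "?c (Inr e) w = (if e \<otimes>\<^bsub>H\<^esub> d = \<one>\<^bsub>H\<^esub> then ys else Inr (e \<otimes>\<^bsub>H\<^esub> d) # ys)"
      if "e \<in> carrier H" for e
      using that d by (auto simp: product_cons_def wd)
    have 2: "?c (Inr e) ys = (if e = \<one>\<^bsub>H\<^esub> then ys else Inr e # ys)" for e
      using ys by (auto simp: product_cons_def split: list.splits sum.splits)
    have 3: "?c (Inr e) (Inr f # ys) = (if e \<otimes>\<^bsub>H\<^esub> f = \<one>\<^bsub>H\<^esub> then ys else Inr (e \<otimes>\<^bsub>H\<^esub> f) # ys)"
      if "e \<in> carrier H" "f \<in> carrier H" "f \<noteq> \<one>\<^bsub>H\<^esub>" for e f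
      using that by (auto simp: product_cons_def)
    show ?thesis using a b d by (auto simp: 1 2 3 H.m_assoc)
  qed
  have one_l: "?c (Inl \<one>\<^bsub>G\<^esub>) w = w" and one_r: "?c (Inr \<one>\<^bsub>H\<^esub>) w = w" for w
    by (auto simp: product_cons_def)
  have assoc1: "foldr ?c (?c x u) v = ?c x (foldr ?c u v)"
    if x: "x \<in> ?L" and u: "u \<in> ?C" and v: "v \<in> ?C" for x u v
  proof -
    have tl: "foldr ?c ys v \<in> ?C" if "u = y # ys" for y ys
      using u v that by (intro foldr_closed) (auto simp: free_product_def)
    show ?thesis
    proof (cases x)
      case (Inl a)
      show ?thesis
      proof (cases "\<exists>d ys. u = Inl d # ys")
        case True
        then obtain d ys where ud: "u = Inl d # ys" by blast
        have "d \<in> carrier G" using u ud by (auto simp: free_product_def)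
        thus ?thesis using merge_l[OF tl[OF ud], of a d] x Inl one_l
          by (auto simp: ud product_cons_def[of G H "Inl a" "Inl d # ys"])
      next
        case False
        hence "?c x u = (if a = \<one>\<^bsub>G\<^esub> then u else x # u)"
          by (auto simp: Inl product_cons_def split: list.splits sum.splits)
        thus ?thesis by (simp add: Inl one_l)
      qed
    next
      case (Inr a)
      show ?thesis
      proof (cases "\<exists>d ys. u = Inr d # ys")
        case True
        then obtain d ys where ud: "u = Inr d # ys" by blast
        have "d \<in> carrier H" using u ud by (auto simp: free_product_def)
        thus ?thesis using merge_r[OF tl[OF ud], of a d] x Inr one_r
          by (auto simp: ud product_cons_def[of G H "Inr a" "Inr d # ys"])
      next
        case False
        hence "?c x u = (if a = \<one>\<^bsub>H\<^esub> then u else x # u)"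
          by (auto simp: Inr product_cons_def split: list.splits sum.splits)
        thus ?thesis by (simp add: Inr one_r)
      qed
    qed
  qed
  have assoc: "foldr ?c (foldr ?c u v) w = foldr ?c u (foldr ?c v w)"
    if "set u \<subseteq> ?L" "v \<in> ?C" "w \<in> ?C" for u v w
    using that by (induction u) (auto simp: assoc1 foldr_closed)
  have sub: "set u \<subseteq> ?L" if "u \<in> ?C" for u using that by (auto simp: free_product_def)
  have inverse: "\<exists>v\<in>?C. foldr ?c v u = []" if "u \<in> ?C" for u
    using that
  proof (induction u)
    case Nil
    show ?case by (intro bexI[of _ "[]"]) (auto simp: free_product_def)
  next
    case (Cons x u)
    have u: "u \<in> ?C" using \<open>\<And>x w. x # w \<in> ?C \<Longrightarrow> w \<in> ?C\<close>[OF Cons.prems] .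
    then obtain v where v: "v \<in> ?C" "foldr ?c v u = []" using Cons.IH by blast
    obtain y where y: "[y] \<in> ?C" "?c y (x # u) = u"
    proof (cases x)
      case (Inl a)
      hence "a \<in> carrier G" "a \<noteq> \<one>\<^bsub>G\<^esub>" using Cons.prems by (auto simp: free_product_def)
      thus ?thesis using that[of "Inl (inv\<^bsub>G\<^esub> a)"] Inl
        by (auto simp: free_product_def product_cons_def Plus_def)
    next
      case (Inr a)
      hence "a \<in> carrier H" "a \<noteq> \<one>\<^bsub>H\<^esub>" using Cons.prems by (auto simp: free_product_def)
      thus ?thesis using that[of "Inr (inv\<^bsub>H\<^esub> a)"] Inr
        by (auto simp: free_product_def product_cons_def Plus_def)
    qed
    have "foldr ?c (foldr ?c v [y]) (x # u) = foldr ?c v (foldr ?c [y] (x # u))"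
      by (rule assoc[OF sub[OF v(1)] y(1) Cons.prems])
    also have "foldr ?c [y] (x # u) = u" using y by simp
    finally have "foldr ?c (foldr ?c v [y]) (x # u) = []" using v by simp
    thus ?case using foldr_closed[OF sub[OF v(1)] y(1)] by blast
  qed
  have ops: "u \<otimes>\<^bsub>free_product G H\<^esub> v = foldr ?c u v" "\<one>\<^bsub>free_product G H\<^esub> = []" for u v
    by (simp_all add: free_product_def)
  show ?thesis
  proof (rule groupI, unfold ops)
    show "[] \<in> ?C" by (simp add: free_product_def)
  qed (use assoc foldr_closed sub inverse in \<open>auto\<close>)
qed


section \<open>Finite generation and the additive group of rationals\<close>

definition finitely_generated :: "('a, 'm) monoid_scheme \<Rightarrow> bool" where
  "finitely_generated G \<longleftrightarrow> (\<exists>S. finite S \<and> S \<subseteq> carrier G \<and> generate G S = carrier G)"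

definition rational_group :: "rat monoid" where
  "rational_group = \<lparr>carrier = UNIV, mult = (+), one = 0\<rparr>"

end

theory Submission
  imports Defs
begin

text \<open>Both halves rest on a counting criterion: the Stone dual of a Boolean ring is metrizable if and
only if the ring is countable. The prime ideals form a closed subset of the Cantor cube over the
ring, so the dual is compact, and metrizable when the ring is countable; conversely, a compact
metrizable space has only countably many clopen subsets, and by the prime ideal theorem distinct
ring elements give distinct clopen sets. Hence the space of ends of \<open>G\<close> is metrizable exactly
when there are only countably many commensurated subsets modulo finite ones
(\<open>metrizable_space_of_ends_iff\<close>).

If an almost invariant function has infinite image, then regrouping its values into infinitely many
infinite blocks gives, for each set of naturals, a commensurated subset, and different sets of naturals
give subsets that differ by an infinite set. So a metrizable space of ends forces tame-endedness
(\<open>tamely_ended_if_metrizable\<close>). On a free group, left multiplication by a fixed element changes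
the last letter of only finitely many reduced words, so the generator at the end of a word is an almost
invariant function; in infinite rank its image is infinite, which gives (a). A finitely generated
group is tamely-ended, so such a free group also provides the second existence claim.

For (b), let \<open>H\<close> be countable and 1-ended, embedded in a countable group \<open>G\<close> that is generated by
\<open>H\<close> and a finite set \<open>T\<close>. A commensurated \<open>A\<close> meets each coset \<open>Hw\<close> in a finite or
cofinite set. Moreover \<open>H\<close> is not locally finite, since a countably infinite locally finite group carries an
almost invariant function with infinite image; so \<open>H\<close> contains an infinite finitely generated
subgroup \<open>L\<close>. The set \<open>A\<close> is invariant under the generators of \<open>L\<close> apart from finitely many
points, so on all but finitely many cosets \<open>Hw\<close> it is empty or everything: a nonempty
\<open>L\<close>-invariant set is infinite. Hence \<open>A\<close> agrees, up to a finite set, with the union of the cosets in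
which it is cofinite (\<open>finite_sym_diff_saturation\<close>). An \<open>H\<close>-invariant set is determined by whether
it contains the identity and by its finite boundary with respect to \<open>T\<close>, and there are only countably
many such data (\<open>countable_ends_algebra\<close>). The free product with the integers is the case where
\<open>T\<close> consists of one element.

The group of rationals is 1-ended because its integers have infinite index: some coset of the integers
misses the finite set on which translation by 1 alters \<open>A\<close>, so it lies inside \<open>A\<close> or outside,
and all other cosets are almost parallel to it. It is not finitely generated, so it gives the first
existence claim.\<close>

section \<open>Stone duality and metrizability\<close>

text \<open>The balls of radius \<open>1/(n+1)\<close> around a finite net, for all \<open>n\<close>, form a countable base, and by compactness a
clopen set is a finite union of its members.\<close>

lemma countable_clopen_compact_metrizable:
  assumes "compact_space T" "metrizable_space T"
  shows "countable {U. openin T U \<and> closedin T U}"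
proof -
  obtain M d where M: "Metric_space M d" and T: "T = Metric_space.mtopology M d"
    using assms(2) unfolding metrizable_space_def by blast
  interpret Metric_space M d by (rule M)
  have "mtotally_bounded M"
    using assms(1) compact_space_eq_mcomplete_mtotally_bounded T by blast
  hence "\<exists>K. finite K \<and> K \<subseteq> M \<and> M \<subseteq> (\<Union>x\<in>K. mball x (1 / Suc n))" for n :: nat
    unfolding mtotally_bounded_def by simp
  then obtain K where K: "\<And>n::nat. finite (K n)" "\<And>n. M \<subseteq> (\<Union>x\<in>K n. mball x (1 / Suc n))"
    by metis
  define \<B> where "\<B> = (\<Union>n. (\<lambda>x. mball x (1 / Suc n)) ` K n)"
  have "countable \<B>"
    unfolding \<B>_def using K(1) by (intro countable_UN countable_image) (auto intro: countable_finite)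
  have "\<exists>\<F>. finite \<F> \<and> \<F> \<subseteq> \<B> \<and> U = \<Union>\<F>" if U: "openin T U" "closedin T U" for U
  proof -
    have cU: "compactin T U" using assms(1) U(2) closedin_compact_space by blast
    have cover: "U \<subseteq> \<Union>{B \<in> \<B>. B \<subseteq> U}"
    proof
      fix x assume x: "x \<in> U"
      obtain r where r: "r > 0" "mball x r \<subseteq> U" using U(1) x T openin_mtopology by blast
      \<comment> \<open>A ball of radius \<open>1/(n+1)\<close> containing \<open>x\<close> is inside the one of twice that radius around \<open>x\<close>.\<close>
      obtain n :: nat where n: "2 / Suc n < r"
        using r(1) reals_Archimedean[of "r/2"] by (auto simp: field_simps)
      have xM: "x \<in> M" using U(1) x T openin_mtopology by blast
      then obtain c where c: "c \<in> K n" "x \<in> mball c (1 / Suc n)" using K(2)[of n] by blast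
      have "mball c (1 / Suc n) \<subseteq> mball x r"
      proof
        fix y assume y: "y \<in> mball c (1 / Suc n)"
        have "d x y \<le> d c x + d c y" using c y by (metis commute in_mball triangle)
        also have "\<dots> < r" using c y n by (auto simp: in_mball)
        finally show "y \<in> mball x r" using y xM by simp
      qed
      thus "x \<in> \<Union>{B \<in> \<B>. B \<subseteq> U}" using c r(2) unfolding \<B>_def by blast
    qed
    have "\<forall>B\<in>{B \<in> \<B>. B \<subseteq> U}. openin T B" by (auto simp: \<B>_def T)
    then obtain \<F> where "finite \<F>" "\<F> \<subseteq> {B \<in> \<B>. B \<subseteq> U}" "U \<subseteq> \<Union>\<F>"
      using cU cover unfolding compactin_def by meson
    thus ?thesis by blast
  qed
  hence "{U. openin T U \<and> closedin T U} \<subseteq> \<Union> ` {\<F>. finite \<F> \<and> \<F> \<subseteq> \<B>}" by blast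
  thus ?thesis
    by (rule countable_subset) (intro countable_image countable_Collect_finite_subset \<open>countable \<B>\<close>)
qed

text \<open>In a Boolean ring \<open>a \<oplus> \<one>\<close> is the complement of \<open>a\<close>.\<close>

locale boolean_ring = cring +
  assumes mult_idem: "a \<in> carrier R \<Longrightarrow> a \<otimes> a = a"
begin

lemma add_self: assumes "a \<in> carrier R" shows "a \<oplus> a = \<zero>"
proof -
  have "(a \<oplus> a) \<oplus> (a \<oplus> a) = (a \<oplus> a) \<otimes> (a \<oplus> a)"
    using assms by (simp add: l_distr r_distr mult_idem[OF assms])
  also have "\<dots> = a \<oplus> a" using mult_idem[of "a \<oplus> a"] assms by blast
  finally show ?thesis using add.l_cancel_one[of "a \<oplus> a" "a \<oplus> a"] assms by simp
qed

lemma mult_add_one: "a \<in> carrier R \<Longrightarrow> a \<otimes> (a \<oplus> \<one>) = \<zero>"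
  using add_self[of a] by (simp add: r_distr mult_idem)

lemma one_notin_prime: "primeideal P R \<Longrightarrow> \<one> \<notin> P"
  using primeideal.I_notcarr[of P R] ideal.one_imp_carrier primeideal.axioms(1) by blast

text \<open>Prime ideals are complements of ultrafilters: of an element and its complement, exactly one
belongs to the ideal.\<close>

lemma prime_add_one_iff:
  assumes "primeideal P R" "a \<in> carrier R"
  shows "a \<oplus> \<one> \<in> P \<longleftrightarrow> a \<notin> P"
proof -
  interpret P: primeideal P R by fact
  have "a \<in> P \<or> a \<oplus> \<one> \<in> P"
    using P.I_prime[of a "a \<oplus> \<one>"] assms(2) by (simp add: mult_add_one P.zero_closed)
  moreover have "\<one> \<in> P" if "a \<in> P" "a \<oplus> \<one> \<in> P"
  proof -
    have "a \<oplus> (a \<oplus> \<one>) = \<one>" using assms(2) by (simp flip: a_assoc add: add_self)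
    thus ?thesis using P.a_closed[OF that] by simp
  qed
  ultimately show ?thesis using one_notin_prime[OF assms(1)] by blast
qed

text \<open>The prime ideal theorem. An ideal that contains the complement of \<open>a\<close> is proper if and only if it avoids
\<open>a\<close>, so an ideal that is maximal with these two properties is a maximal ideal, hence prime.\<close>

lemma prime_avoiding:
  assumes a: "a \<in> carrier R" "a \<noteq> \<zero>"
  obtains P where "primeideal P R" "a \<notin> P"
proof -
  define \<A> where "\<A> = {I. ideal I R \<and> a \<oplus> \<one> \<in> I \<and> a \<notin> I}"
  have "PIdl (a \<oplus> \<one>) \<in> \<A>"
  proof -
    have "a \<notin> PIdl (a \<oplus> \<one>)"
    proof
      assume "a \<in> PIdl (a \<oplus> \<one>)"
      then obtain x where x: "x \<in> carrier R" "a = x \<otimes> (a \<oplus> \<one>)" unfolding cgenideal_def by blast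
      have "a = a \<otimes> a" using a by (simp add: mult_idem)
      also have "\<dots> = x \<otimes> (a \<otimes> (a \<oplus> \<one>))" using x a(1) by (metis a_closed m_lcomm one_closed)
      finally show False using a x by (simp add: mult_add_one)
    qed
    thus ?thesis using a by (simp add: \<A>_def cgenideal_ideal cgenideal_self)
  qed
  moreover have "\<Union>C \<in> \<A>" if C: "C \<noteq> {}" "subset.chain \<A> C" for C
  proof -
    have "subset.chain {I. ideal I R} C" using C unfolding subset_chain_def \<A>_def by blast
    hence "ideal (\<Union>C) R" using chain_Union_is_ideal[of C] C(1) by simp
    thus ?thesis using C unfolding subset_chain_def \<A>_def by blast
  qed
  ultimately obtain M where M: "M \<in> \<A>" "\<And>J. J \<in> \<A> \<Longrightarrow> M \<subseteq> J \<Longrightarrow> J = M"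
    using subset_Zorn_nonempty[of \<A>] by blast
  have "maximalideal M R"
  proof (rule maximalidealI)
    fix J assume J: "ideal J R" "M \<subseteq> J" "J \<subseteq> carrier R"
    interpret J: ideal J R by fact
    show "J = M \<or> J = carrier R"
    proof (cases "a \<in> J")
      case True
      moreover have "a \<oplus> \<one> \<in> J" using M(1) J(2) by (auto simp: \<A>_def)
      ultimately have "a \<oplus> (a \<oplus> \<one>) \<in> J" by (rule J.a_closed)
      hence "\<one> \<in> J" using a(1) by (simp flip: a_assoc add: add_self)
      thus ?thesis using J.one_imp_carrier by blast
    next
      case False
      thus ?thesis using M J by (auto simp: \<A>_def)
    qed
  qed (use M(1) a in \<open>auto simp: \<A>_def\<close>)
  hence "primeideal M R" by (rule maximalideal_prime)
  thus thesis using that M(1) by (auto simp: \<A>_def)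
qed

text \<open>The topology on prime ideals is that of pointwise convergence of characteristic functions; the
embedding \<open>char_prime\<close> into the Cantor cube therefore gives compactness (Tychonoff) and metrizability
(countable products) together.\<close>

abbreviation (input) cube :: "('a \<Rightarrow> bool) topology" where
  "cube \<equiv> product_topology (\<lambda>_. discrete_topology UNIV) (carrier R)"

definition char_prime :: "'a set \<Rightarrow> 'a \<Rightarrow> bool" where
  "char_prime P = (\<lambda>a\<in>carrier R. a \<in> P)"

lemma topspace_stone_dual: "topspace (stone_dual R) = {P. primeideal P R}"
  using one_notin_prime unfolding stone_dual_def topology_generated_by_topspace by blast

lemma openin_stone_dual:
  "a \<in> carrier R \<Longrightarrow> openin (stone_dual R) {P. primeideal P R \<and> a \<notin> P}"
  unfolding stone_dual_def by (rule topology_generated_by_Basis) blast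

lemma openin_stone_dual':
  assumes "a \<in> carrier R"
  shows "openin (stone_dual R) {P. primeideal P R \<and> a \<in> P}"
proof -
  have "{P. primeideal P R \<and> a \<in> P} = {P. primeideal P R \<and> a \<oplus> \<one> \<notin> P}"
    using prime_add_one_iff assms by blast
  thus ?thesis using openin_stone_dual assms by simp
qed

lemma open_coordinate:
  assumes "a \<in> carrier R"
  shows "openin cube {x \<in> topspace cube. x a = b}" "closedin cube {x \<in> topspace cube. x a = b}"
proof -
  have *: "continuous_map cube (discrete_topology UNIV) (\<lambda>x. x a)"
    using assms by (rule continuous_map_product_projection)
  show "openin cube {x \<in> topspace cube. x a = b}"
    using openin_continuous_map_preimage[OF *, of "{b}"] by simp
  show "closedin cube {x \<in> topspace cube. x a = b}"
    using closedin_continuous_map_preimage[OF *, of "{b}"] by simp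
qed

lemma stone_dual_homeomorphic_cube:
  "stone_dual R homeomorphic_space subtopology cube (char_prime ` {P. primeideal P R})"
proof -
  define g where "g = (\<lambda>x. {a \<in> carrier R. x a})"
  let ?Y = "subtopology cube (char_prime ` {P. primeideal P R})"
  have g: "g (char_prime P) = P" if "primeideal P R" for P
  proof -
    interpret primeideal P R by fact
    show ?thesis using a_subset by (auto simp: g_def char_prime_def)
  qed
  have top: "topspace ?Y = char_prime ` {P. primeideal P R}"
    by (auto simp: char_prime_def PiE_def)
  have 1: "continuous_map (stone_dual R) cube char_prime"
    unfolding continuous_map_componentwise
  proof (intro conjI ballI)
    fix a assume a: "a \<in> carrier R"
    have "openin (stone_dual R) {P \<in> topspace (stone_dual R). char_prime P a \<in> V}" for V
    proof -
      have "{P \<in> topspace (stone_dual R). char_prime P a \<in> V} =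
        (if True \<in> V then {P. primeideal P R \<and> a \<in> P} else {}) \<union>
        (if False \<in> V then {P. primeideal P R \<and> a \<notin> P} else {})"
        using a by (cases "True \<in> V"; cases "False \<in> V")
          (auto simp: topspace_stone_dual char_prime_def, (metis (full_types))+)
      thus ?thesis using openin_stone_dual openin_stone_dual' a by (simp add: openin_Un)
    qed
    thus "continuous_map (stone_dual R) (discrete_topology UNIV) (\<lambda>P. char_prime P a)"
      by (simp add: continuous_map_def)
  qed (auto simp: char_prime_def)
  have 2: "continuous_map ?Y (stone_dual R) g"
    unfolding stone_dual_def
  proof (rule continuous_on_generated_topo)
    fix U assume "U \<in> {{P. primeideal P R \<and> a \<notin> P} |a. a \<in> carrier R}"
    then obtain a where a: "a \<in> carrier R" "U = {P. primeideal P R \<and> a \<notin> P}" by blast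
    have "g -` U \<inter> topspace ?Y = {x \<in> topspace cube. x a = False} \<inter> char_prime ` {P. primeideal P R}"
      using g a(1) unfolding top a(2) by (auto simp: char_prime_def)
    thus "openin ?Y (g -` U \<inter> topspace ?Y)"
      by (simp only:) (rule openin_subtopology_Int[OF open_coordinate(1)[OF a(1)]])
  next
    show "g ` topspace ?Y \<subseteq> \<Union> {{P. primeideal P R \<and> a \<notin> P} |a. a \<in> carrier R}"
    proof
      fix P assume "P \<in> g ` topspace ?Y"
      hence "primeideal P R" using g unfolding top by auto
      thus "P \<in> \<Union> {{P. primeideal P R \<and> a \<notin> P} |a. a \<in> carrier R}"
        using one_notin_prime by blast
    qed
  qed
  have "homeomorphic_maps (stone_dual R) ?Y char_prime g"
    unfolding homeomorphic_maps_def
    using 1 2 g by (auto simp: continuous_map_in_subtopology top topspace_stone_dual)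
  thus ?thesis unfolding homeomorphic_space_def by blast
qed

text \<open>Each defining property of a prime ideal, for fixed ring elements, only involves finitely many
coordinates, so it cuts out a clopen subset of the cube.\<close>

lemma closed_char_primes: "closedin cube (char_prime ` {P. primeideal P R})"
proof -
  let ?T = "topspace cube"
  let ?E = "\<lambda>a b. {x \<in> ?T. x a = b}"
  have xt: "x \<in> extensional (carrier R)" if "x \<in> ?T" for x using that by (auto simp: PiE_def)
  define C where "C = ?E \<zero> True \<inter> ?E \<one> False \<inter>
    (\<Inter>a\<in>carrier R. \<Inter>b\<in>carrier R.
      (?E a False \<union> ?E b False \<union> ?E (a \<oplus> b) True) \<inter> (?E a False \<union> ?E (a \<otimes> b) True) \<inter>
      (?E (a \<otimes> b) False \<union> ?E a True \<union> ?E b True))"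
  have "closedin cube C"
    unfolding C_def using carrier_not_empty
    by (intro closedin_Int closedin_INT closedin_Un open_coordinate(2)) auto
  moreover have "char_prime ` {P. primeideal P R} = C"
  proof (intro equalityI subsetI)
    fix x assume "x \<in> char_prime ` {P. primeideal P R}"
    then obtain P where P: "primeideal P R" "x = char_prime P" by blast
    interpret P: primeideal P R by fact
    show "x \<in> C"
      using P.zero_closed one_notin_prime[OF P(1)] P.a_closed P.I_r_closed P.I_prime
      unfolding C_def P(2) by (auto simp: char_prime_def)
  next
    fix x assume x: "x \<in> C"
    define P where "P = {a \<in> carrier R. x a}"
    have zero: "x \<zero>" and one: "\<not> x \<one>" and T: "x \<in> ?T"
      and add: "\<And>a b. a \<in> carrier R \<Longrightarrow> b \<in> carrier R \<Longrightarrow> x a \<Longrightarrow> x b \<Longrightarrow> x (a \<oplus> b)"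
      and mult: "\<And>a b. a \<in> carrier R \<Longrightarrow> b \<in> carrier R \<Longrightarrow> x a \<Longrightarrow> x (a \<otimes> b)"
      and prime: "\<And>a b. a \<in> carrier R \<Longrightarrow> b \<in> carrier R \<Longrightarrow> x (a \<otimes> b) \<Longrightarrow> x a \<or> x b"
      using x unfolding C_def by auto
    have "primeideal P R"
    proof (rule primeidealI[OF idealI])
      show "subgroup P (add_monoid R)"
      proof (rule add.subgroupI)
        fix a assume a: "a \<in> P"
        have "a \<oplus> a = \<zero>" using a by (simp add: P_def add_self)
        hence "\<ominus> a = a" using a by (simp add: P_def minus_equality)
        thus "\<ominus> a \<in> P" using a by simp
      qed (use zero add in \<open>auto simp: P_def\<close>)
    qed (use is_cring one prime mult in \<open>auto simp: P_def m_comm ring_axioms is_cring\<close>)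
    moreover have "x = char_prime P"
      using xt[OF T] by (intro ext) (auto simp: char_prime_def P_def extensional_def restrict_def)
    ultimately show "x \<in> char_prime ` {P. primeideal P R}" by blast
  qed
  ultimately show ?thesis by simp
qed

lemma compact_stone_dual: "compact_space (stone_dual R)"
proof -
  have "compact_space cube" by (simp add: compact_space_product_topology compact_space_discrete_topology)
  hence "compact_space (subtopology cube (char_prime ` {P. primeideal P R}))"
    using closed_char_primes closedin_compact_space compact_space_subtopology by blast
  thus ?thesis using homeomorphic_compact_space stone_dual_homeomorphic_cube by blast
qed

text \<open>For the converse implication, the basic open sets are clopen and, by the prime ideal theorem applied to
\<open>a \<oplus> b\<close>, different elements \<open>a\<close> and \<open>b\<close> define different ones.\<close>

theorem metrizable_stone_dual_iff: "metrizable_space (stone_dual R) \<longleftrightarrow> countable (carrier R)"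
proof
  assume "countable (carrier R)"
  hence "metrizable_space cube" unfolding metrizable_space_product_topology
    by (auto intro: countable_subset[of _ "carrier R"])
  thus "metrizable_space (stone_dual R)"
    using homeomorphic_metrizable_space[OF stone_dual_homeomorphic_cube] metrizable_space_subtopology by blast
next
  assume "metrizable_space (stone_dual R)"
  hence *: "countable {U. openin (stone_dual R) U \<and> closedin (stone_dual R) U}"
    by (intro countable_clopen_compact_metrizable compact_stone_dual)
  define D where "D a = {P. primeideal P R \<and> a \<notin> P}" for a
  have "closedin (stone_dual R) (D a)" if "a \<in> carrier R" for a
  proof -
    have "topspace (stone_dual R) - D a = {P. primeideal P R \<and> a \<in> P}"
      by (auto simp: D_def topspace_stone_dual)
    thus ?thesis using openin_stone_dual'[OF that]
      by (auto simp: closedin_def D_def topspace_stone_dual)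
  qed
  hence "D ` carrier R \<subseteq> {U. openin (stone_dual R) U \<and> closedin (stone_dual R) U}"
    using openin_stone_dual by (auto simp: D_def)
  hence "countable (D ` carrier R)" using * countable_subset by blast
  moreover have "inj_on D (carrier R)"
  proof (rule inj_onI, rule ccontr)
    fix a b assume ab: "a \<in> carrier R" "b \<in> carrier R" "D a = D b" "a \<noteq> b"
    have "a \<oplus> b \<noteq> \<zero>"
    proof
      assume "a \<oplus> b = \<zero>"
      hence "a \<oplus> b = b \<oplus> b" using ab by (simp add: add_self)
      thus False using ab by simp
    qed
    then obtain P where P: "primeideal P R" "a \<oplus> b \<notin> P"
      using prime_avoiding[of "a \<oplus> b"] ab by blast
    interpret P: primeideal P R by fact
    have "a \<notin> P" "b \<notin> P" using P ab(3) P.a_closed unfolding D_def by blast+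
    hence "a \<oplus> \<one> \<in> P" "b \<oplus> \<one> \<in> P" using prime_add_one_iff P(1) ab by blast+
    hence "(a \<oplus> \<one>) \<oplus> (b \<oplus> \<one>) \<in> P" by (rule P.a_closed)
    moreover have "(a \<oplus> \<one>) \<oplus> (b \<oplus> \<one>) = (a \<oplus> b) \<oplus> (\<one> \<oplus> \<one>)"
      using ab by (simp add: a_ac)
    ultimately show False using P(2) ab by (simp add: add_self)
  qed
  ultimately show "countable (carrier R)" by (rule countable_image_inj_on)
qed

end

section \<open>Commensurated subsets and the space of ends\<close>

context group
begin

lemma left_commensurated_iff_almost_invariant:
  "left_commensurated G A \<longleftrightarrow> A \<subseteq> carrier G \<and> left_almost_invariant G (\<lambda>h. h \<in> A)"
proof (cases "A \<subseteq> carrier G")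
  case True
  have *: "{h \<in> carrier G. (g \<otimes> h \<in> A) \<noteq> (h \<in> A)} = sym_diff (inv g <# A) A"
    if g: "g \<in> carrier G" for g
  proof -
    have "h \<in> inv g <# A \<longleftrightarrow> h \<in> carrier G \<and> g \<otimes> h \<in> A" for h
    proof
      assume "h \<in> inv g <# A"
      then obtain a where "a \<in> A" "h = inv g \<otimes> a" unfolding l_coset_def by blast
      thus "h \<in> carrier G \<and> g \<otimes> h \<in> A" using g True by (auto simp: inv_solve_left' subset_iff simp flip: m_assoc)
    next
      assume h: "h \<in> carrier G \<and> g \<otimes> h \<in> A"
      hence "h = inv g \<otimes> (g \<otimes> h)" using g by (simp flip: m_assoc)
      thus "h \<in> inv g <# A" using h unfolding l_coset_def by blast
    qed
    thus ?thesis using True by blast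
  qed
  have "left_almost_invariant G (\<lambda>h. h \<in> A) \<longleftrightarrow>
      (\<forall>g\<in>carrier G. finite (sym_diff (inv g <# A) A))"
    unfolding left_almost_invariant_def using * by simp
  also have "\<dots> \<longleftrightarrow> (\<forall>g\<in>carrier G. finite (sym_diff (g <# A) A))"
    by (metis inv_closed inv_inv)
  finally show ?thesis using True unfolding left_commensurated_def by blast
qed (auto simp: left_commensurated_def)

lemma left_commensurated_vimage:
  assumes "left_almost_invariant G f"
  shows "left_commensurated G {h \<in> carrier G. f h \<in> V}"
proof -
  have "left_almost_invariant G (\<lambda>h. h \<in> {h \<in> carrier G. f h \<in> V})"
    unfolding left_almost_invariant_def
  proof
    fix g assume g: "g \<in> carrier G"
    have "finite {h \<in> carrier G. f (g \<otimes> h) \<noteq> f h}"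
      using assms g unfolding left_almost_invariant_def by blast
    thus "finite {h \<in> carrier G. (g \<otimes> h \<in> {h \<in> carrier G. f h \<in> V}) \<noteq> (h \<in> {h \<in> carrier G. f h \<in> V})}"
      by (rule rev_finite_subset) (use g in auto)
  qed
  thus ?thesis unfolding left_commensurated_iff_almost_invariant by blast
qed

definition end_class :: "'a set \<Rightarrow> 'a set set" where
  "end_class A = finite_subsets G +>\<^bsub>commensurated_algebra G\<^esub> A"

lemma carrier_ends_algebra:
  "carrier (ends_algebra G) = end_class ` {A. left_commensurated G A}"
  unfolding ends_algebra_def end_class_def FactRing_def A_RCOSETS_def'
  by (auto simp: commensurated_algebra_def)

lemma end_class_eq_iff:
  assumes "left_commensurated G A" "left_commensurated G B"
  shows "end_class A = end_class B \<longleftrightarrow> finite (sym_diff A B)"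
proof -
  let ?R = "commensurated_algebra G"
  interpret R: cring ?R by (rule cring_commensurated_algebra)
  have B: "B \<in> carrier ?R" and A: "A \<in> carrier ?R" using assms by (auto simp: commensurated_algebra_def)
  have "\<ominus>\<^bsub>?R\<^esub> B = B"
    by (rule R.minus_equality) (use assms in \<open>auto simp: commensurated_algebra_def\<close>)
  hence "A \<ominus>\<^bsub>?R\<^esub> B = sym_diff A B" by (simp add: a_minus_def commensurated_algebra_def)
  moreover have "sym_diff A B \<subseteq> carrier G" using assms unfolding left_commensurated_def by blast
  ultimately show ?thesis
    using R.quotient_eq_iff_same_a_r_cos[OF ideal_finite_subsets A B]
    by (auto simp: finite_subsets_def end_class_def)
qed

lemma boolean_ring_ends_algebra: "boolean_ring (ends_algebra G)"
proof -
  interpret I: ideal "finite_subsets G" "commensurated_algebra G" by (rule ideal_finite_subsets)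
  show ?thesis
  proof (intro boolean_ring.intro boolean_ring_axioms.intro cring_ends_algebra)
    fix a assume "a \<in> carrier (ends_algebra G)"
    then obtain A where A: "left_commensurated G A" "a = end_class A"
      unfolding carrier_ends_algebra by blast
    have "A \<in> carrier (commensurated_algebra G)" "A \<otimes>\<^bsub>commensurated_algebra G\<^esub> A = A"
      using A by (auto simp: commensurated_algebra_def)
    thus "a \<otimes>\<^bsub>ends_algebra G\<^esub> a = a"
      using A(2) I.rcoset_mult_add[of A A] by (simp add: ends_algebra_def FactRing_def end_class_def)
  qed
qed

theorem metrizable_space_of_ends_iff:
  "metrizable_space (space_of_ends G) \<longleftrightarrow> countable (carrier (ends_algebra G))"
  unfolding space_of_ends_def
  by (rule boolean_ring.metrizable_stone_dual_iff[OF boolean_ring_ends_algebra])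

lemma one_ended_iff:
  "one_ended G \<longleftrightarrow> infinite (carrier G) \<and>
     (\<forall>A. left_commensurated G A \<longrightarrow> finite A \<or> finite (carrier G - A))"
proof -
  interpret I: ideal "finite_subsets G" "commensurated_algebra G" by (rule ideal_finite_subsets)
  have lc: "left_commensurated G {}" "left_commensurated G (carrier G)"
    by (auto simp: left_commensurated_finite left_commensurated_carrier)
  have zero: "\<zero>\<^bsub>ends_algebra G\<^esub> = end_class {}"
    using I.a_rcos_zero[OF I.ideal_axioms additive_subgroup.zero_closed[OF I.is_additive_subgroup]]
    by (simp add: ends_algebra_def FactRing_def end_class_def commensurated_algebra_def)
  have one: "\<one>\<^bsub>ends_algebra G\<^esub> = end_class (carrier G)"
    by (simp add: ends_algebra_def FactRing_def end_class_def commensurated_algebra_def)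
  have ne: "end_class {} \<noteq> end_class (carrier G) \<longleftrightarrow> infinite (carrier G)"
    using end_class_eq_iff[OF lc] by simp
  have "carrier (ends_algebra G) = {end_class {}, end_class (carrier G)} \<longleftrightarrow>
      (\<forall>A. left_commensurated G A \<longrightarrow> end_class A = end_class {} \<or> end_class A = end_class (carrier G))"
    unfolding carrier_ends_algebra using lc by auto
  also have "\<dots> \<longleftrightarrow> (\<forall>A. left_commensurated G A \<longrightarrow> finite A \<or> finite (carrier G - A))"
  proof -
    have "sym_diff A (carrier G) = carrier G - A" if "left_commensurated G A" for A
      using that unfolding left_commensurated_def by blast
    thus ?thesis using lc by (simp add: end_class_eq_iff cong: conj_cong imp_cong)
  qed
  finally show ?thesis unfolding one_ended_def zero one ne by blast
qed

section \<open>Tamely-ended groups\<close>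

text \<open>An almost invariant function with infinite image yields a commensurated subset \<open>A N\<close> for each set
\<open>N\<close> of naturals. The values are first grouped into infinite blocks \<open>C i\<close>, because the
fibres of the function may be finite: this makes the preimage of each block infinite, so that \<open>A\<close>
remains injective modulo finite sets.\<close>

theorem tamely_ended_if_metrizable:
  assumes "metrizable_space (space_of_ends G)"
  shows "tamely_ended G"
  unfolding tamely_ended_def
proof (intro allI impI, rule ccontr)
  fix f :: "'a \<Rightarrow> 'a"
  assume f: "left_almost_invariant G f" and inf: "infinite (f ` carrier G)"
  obtain C :: "nat \<Rightarrow> 'a set" where C: "pairwise (\<lambda>i j. disjnt (C i) (C j)) UNIV"
      "(\<Union>i. C i) \<subseteq> f ` carrier G" "\<And>i. infinite (C i)"
    using infinite_infinite_partition[OF inf] by blast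
  define A where "A N = {h \<in> carrier G. f h \<in> (\<Union>i\<in>N. C i)}" for N
  have lc: "left_commensurated G (A N)" for N
    unfolding A_def using f by (rule left_commensurated_vimage)
  have sep: "M \<subseteq> N" if "finite (sym_diff (A M) (A N))" for M N
  proof
    fix i assume i: "i \<in> M"
    show "i \<in> N"
    proof (rule ccontr)
      assume "i \<notin> N"
      hence "{h \<in> carrier G. f h \<in> C i} \<subseteq> sym_diff (A M) (A N)"
      proof -
        have "C i \<inter> C j = {}" if "j \<in> N" for j
          using pairwiseD[OF C(1), of i j] \<open>i \<notin> N\<close> that unfolding disjnt_def by auto
        hence "C i \<inter> (\<Union>j\<in>N. C j) = {}" by blast
        thus ?thesis using i unfolding A_def by blast
      qed
      hence "finite (f ` {h \<in> carrier G. f h \<in> C i})"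
        by (intro finite_imageI finite_subset[OF _ that])
      moreover have "C i \<subseteq> f ` {h \<in> carrier G. f h \<in> C i}" using C(2) by blast
      ultimately show False using C(3)[of i] by (metis finite_subset)
    qed
  qed
  have "inj (\<lambda>N. end_class (A N))"
  proof (rule injI)
    fix M N assume "end_class (A M) = end_class (A N)"
    hence "finite (sym_diff (A M) (A N))" using end_class_eq_iff lc by blast
    thus "M = N" using sep[of M N] sep[of N M] by (simp add: Un_commute)
  qed
  moreover have "range (\<lambda>N. end_class (A N)) \<subseteq> carrier (ends_algebra G)"
    unfolding carrier_ends_algebra using lc by blast
  moreover have "countable (carrier (ends_algebra G))"
    using assms metrizable_space_of_ends_iff by blast
  ultimately have "countable (UNIV :: nat set set)"
    using countable_image_inj_on[OF countable_subset] by blast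
  hence "range (from_nat_into (UNIV :: nat set set)) = UNIV"
    by (intro range_from_nat_into) auto
  thus False using Cantors_theorem[of "UNIV :: nat set"] by auto
qed

lemma one_ended_imp_tamely_ended:
  assumes "one_ended G" shows "tamely_ended G"
proof -
  have "countable (carrier (ends_algebra G))" using assms unfolding one_ended_def by simp
  thus ?thesis using tamely_ended_if_metrizable metrizable_space_of_ends_iff by blast
qed

text \<open>From \<open>w\<close> one reaches \<open>g \<otimes> w\<close> by multiplying successively by generators and their inverses. Unless the
value of \<open>f\<close> stays the same all along, there is a first point \<open>l \<otimes> w\<close> that still carries the value
\<open>f w\<close> while the next point does not.\<close>

lemma constant_on_orbit_or_jump:
  assumes K: "K \<subseteq> carrier G" and "g \<in> generate G K" "w \<in> carrier G"
  shows "f (g \<otimes> w) = f w \<or>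
    (\<exists>l\<in>generate G K. \<exists>k\<in>K \<union> m_inv G ` K. f (k \<otimes> (l \<otimes> w)) \<noteq> f (l \<otimes> w) \<and> f (l \<otimes> w) = f w)"
  using assms(2,3)
proof (induction arbitrary: w rule: generate.induct)
  case (incl k)
  have "k \<in> K \<union> m_inv G ` K" "\<one> \<otimes> w = w" using incl by auto
  thus ?case using generate.one[of G K] by metis
next
  case (inv k)
  have "inv k \<in> K \<union> m_inv G ` K" "\<one> \<otimes> w = w" using inv by auto
  thus ?case using generate.one[of G K] by metis
next
  case (eng a b)
  have ab: "a \<in> carrier G" "b \<in> carrier G" using eng.hyps K generate_in_carrier by blast+
  have assoc: "l \<otimes> (b \<otimes> w) = (l \<otimes> b) \<otimes> w" if "l \<in> generate G K" for l
    using that ab eng.prems K generate_in_carrier m_assoc by metis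
  show ?case
  proof (cases "f (b \<otimes> w) = f w")
    case True
    have "b \<otimes> w \<in> carrier G" using ab eng.prems by simp
    from eng.IH(1)[OF this] show ?thesis
    proof
      assume "f (a \<otimes> (b \<otimes> w)) = f (b \<otimes> w)"
      thus ?thesis using True assoc[OF eng.hyps(1)] by simp
    next
      assume "\<exists>l\<in>generate G K. \<exists>k\<in>K \<union> m_inv G ` K.
        f (k \<otimes> (l \<otimes> (b \<otimes> w))) \<noteq> f (l \<otimes> (b \<otimes> w)) \<and> f (l \<otimes> (b \<otimes> w)) = f (b \<otimes> w)"
      then obtain l k where l: "l \<in> generate G K" "k \<in> K \<union> m_inv G ` K"
        "f (k \<otimes> (l \<otimes> (b \<otimes> w))) \<noteq> f (l \<otimes> (b \<otimes> w))" "f (l \<otimes> (b \<otimes> w)) = f (b \<otimes> w)" by blast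
      have "l \<otimes> b \<in> generate G K" using l(1) eng.hyps(2) by (rule generate.eng)
      moreover have "f (k \<otimes> ((l \<otimes> b) \<otimes> w)) \<noteq> f ((l \<otimes> b) \<otimes> w)" "f ((l \<otimes> b) \<otimes> w) = f w"
        using l(3,4) True unfolding assoc[OF l(1)] by simp_all
      ultimately show ?thesis using l(2) by blast
    qed
  next
    case False
    thus ?thesis using eng.IH(2)[OF eng.prems] by blast
  qed
qed simp

definition jumps :: "('a \<Rightarrow> 'i) \<Rightarrow> 'a set \<Rightarrow> 'a set" where
  "jumps f K = {w \<in> carrier G. \<exists>k\<in>K \<union> m_inv G ` K. f (k \<otimes> w) \<noteq> f w}"

lemma finite_jumps:
  assumes "left_almost_invariant G f" "finite K" "K \<subseteq> carrier G"
  shows "finite (jumps f K)"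
proof -
  have "jumps f K = (\<Union>k\<in>K \<union> m_inv G ` K. {w \<in> carrier G. f (k \<otimes> w) \<noteq> f w})"
    unfolding jumps_def by blast
  moreover have "finite {w \<in> carrier G. f (k \<otimes> w) \<noteq> f w}" if "k \<in> K \<union> m_inv G ` K" for k
    using that assms unfolding left_almost_invariant_def by (blast intro: inv_closed)
  ultimately show ?thesis using assms(2) by simp
qed

text \<open>Walking from any \<open>w\<close> to the identity, the value \<open>f w\<close> either survives to the end or is
taken at one of the finitely many jumps.\<close>

theorem finitely_generated_imp_tamely_ended:
  assumes "finitely_generated G" shows "tamely_ended G"
  unfolding tamely_ended_def
proof (intro allI impI)
  fix f :: "'a \<Rightarrow> 'a" assume f: "left_almost_invariant G f"
  obtain K where K: "finite K" "K \<subseteq> carrier G" "generate G K = carrier G"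
    using assms unfolding finitely_generated_def by blast
  have "f ` carrier G \<subseteq> insert (f \<one>) (f ` jumps f K)"
  proof
    fix y assume "y \<in> f ` carrier G"
    then obtain w where w: "w \<in> carrier G" "y = f w" by blast
    from constant_on_orbit_or_jump[OF K(2), of "inv w" w f] w K(3)
    have "f \<one> = f w \<or> (\<exists>l\<in>carrier G. l \<otimes> w \<in> jumps f K \<and> f (l \<otimes> w) = f w)"
      unfolding jumps_def by auto
    thus "y \<in> insert (f \<one>) (f ` jumps f K)" using w by (metis imageI insertCI)
  qed
  thus "finite (f ` carrier G)" by (rule finite_subset) (simp add: finite_jumps[OF f K(1,2)])
qed

end

section \<open>One-ended groups\<close>

text \<open>This is used both for isomorphisms and for the map \<open>h \<mapsto> \<iota> h \<otimes> w\<close> onto a coset of an embedded group.\<close>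

lemma left_almost_invariant_comp:
  assumes f: "left_almost_invariant G f"
    and \<iota>: "\<And>k. k \<in> carrier H \<Longrightarrow> \<iota> k \<in> carrier G"
    and \<theta>: "\<theta> ` carrier H \<subseteq> carrier G" "inj_on \<theta> (carrier H)"
    and equivariant: "\<And>k h. k \<in> carrier H \<Longrightarrow> h \<in> carrier H \<Longrightarrow> \<theta> (k \<otimes>\<^bsub>H\<^esub> h) = \<iota> k \<otimes>\<^bsub>G\<^esub> \<theta> h"
  shows "left_almost_invariant H (f \<circ> \<theta>)"
  unfolding left_almost_invariant_def
proof
  fix k assume k: "k \<in> carrier H"
  let ?E = "{h \<in> carrier H. (f \<circ> \<theta>) (k \<otimes>\<^bsub>H\<^esub> h) \<noteq> (f \<circ> \<theta>) h}"
  have "\<theta> ` ?E \<subseteq> {x \<in> carrier G. f (\<iota> k \<otimes>\<^bsub>G\<^esub> x) \<noteq> f x}"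
    using \<theta>(1) equivariant[OF k] by auto
  moreover have "finite {x \<in> carrier G. f (\<iota> k \<otimes>\<^bsub>G\<^esub> x) \<noteq> f x}"
    using f \<iota>[OF k] unfolding left_almost_invariant_def by blast
  ultimately have "finite (\<theta> ` ?E)" by (rule finite_subset)
  thus "finite ?E" by (rule finite_imageD) (rule inj_on_subset[OF \<theta>(2)], blast)
qed

context group
begin

lemma eq_one_if_invariant:
  assumes K: "K \<subseteq> carrier G"
    and inv: "\<And>k w. k \<in> K \<Longrightarrow> w \<in> carrier G \<Longrightarrow> f (k \<otimes> w) = f w"
    and g: "g \<in> generate G K"
  shows "f g = f \<one>"
proof -
  have *: "f (k \<otimes> w) = f w" if k: "k \<in> K \<union> m_inv G ` K" and w: "w \<in> carrier G" for k w
  proof (cases "k \<in> K")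
    case False
    then obtain k' where k': "k' \<in> K" "k = inv k'" using k by blast
    have "k' \<in> carrier G" using k'(1) K by blast
    hence "k' \<otimes> (k \<otimes> w) = w" "k \<otimes> w \<in> carrier G" using w k'(2) by (simp_all flip: m_assoc)
    thus ?thesis using inv[OF k'(1), of "k \<otimes> w"] by simp
  qed (simp add: inv w)
  have "\<not> (\<exists>l\<in>generate G K. \<exists>k\<in>K \<union> m_inv G ` K. f (k \<otimes> (l \<otimes> \<one>)) \<noteq> f (l \<otimes> \<one>) \<and> f (l \<otimes> \<one>) = f \<one>)"
    using * generate_in_carrier[OF K] by simp
  hence "f (g \<otimes> \<one>) = f \<one>"
    using constant_on_orbit_or_jump[OF K g one_closed, of f] by blast
  thus ?thesis using generate_in_carrier[OF K g] by simp
qed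

text \<open>Otherwise the group is the union of an increasing sequence of finite subgroups \<open>F n\<close>. The first
index at which an element appears is then an almost invariant function: multiplication by
\<open>g \<in> F m\<close> preserves \<open>F n\<close> for \<open>n \<ge> m\<close>, so it can only change the level inside
\<open>F m\<close>. The image must be finite, hence so is the group.\<close>

lemma one_ended_imp_infinite_finitely_generated_subgroup:
  assumes "one_ended G" "countable (carrier G)"
  obtains K where "finite K" "K \<subseteq> carrier G" "infinite (generate G K)"
proof (rule ccontr)
  assume no: "\<not> thesis"
  define F where "F n = generate G (from_nat_into (carrier G) ` {..<n})" for n :: nat
  have sub: "from_nat_into (carrier G) ` {..<n} \<subseteq> carrier G" for n
    using from_nat_into[of "carrier G"] carrier_not_empty by blast
  have fin: "finite (F n)" for n unfolding F_def using no that sub by blast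
  have sg: "subgroup (F n) G" for n unfolding F_def by (rule generate_is_subgroup[OF sub])
  have mono: "F m \<subseteq> F n" if "m \<le> n" for m n
    unfolding F_def by (rule mono_generate) (use that in auto)
  have exhaust: "\<exists>n. g \<in> F n" if g: "g \<in> carrier G" for g
  proof -
    obtain n where "g = from_nat_into (carrier G) n" using from_nat_into_surj[OF assms(2) g] by metis
    hence "g \<in> F (Suc n)" unfolding F_def by (intro generate.incl) auto
    thus ?thesis by blast
  qed
  define level where "level h = (LEAST n. h \<in> F n)" for h
  have level: "h \<in> F (level h)" if "h \<in> carrier G" for h
    unfolding level_def using exhaust[OF that] by (rule LeastI_ex)
  have "left_almost_invariant G level"
    unfolding left_almost_invariant_def
  proof
    fix g assume g: "g \<in> carrier G"
    then obtain m where m: "g \<in> F m" using exhaust by blast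
    have "level (g \<otimes> h) = level h" if h: "h \<in> carrier G" "h \<notin> F m" for h
    proof -
      have shift: "g \<otimes> h \<in> F n \<longleftrightarrow> h \<in> F n" if "g \<in> F n" for n
      proof
        assume "g \<otimes> h \<in> F n"
        hence "inv g \<otimes> (g \<otimes> h) \<in> F n" using that sg subgroup.m_inv_closed subgroup.m_closed by metis
        thus "h \<in> F n" using g h(1) by (simp flip: m_assoc)
      qed (use that sg subgroup.m_closed in metis)
      have "g \<otimes> h \<in> F n \<longleftrightarrow> h \<in> F n" for n
      proof (cases "m \<le> n")
        case True
        thus ?thesis using shift mono m by blast
      next
        case False
        hence "F n \<subseteq> F m" by (intro mono) simp
        thus ?thesis using shift[OF m] h(2) by blast
      qed
      thus ?thesis unfolding level_def by simp
    qed
    hence "{h \<in> carrier G. level (g \<otimes> h) \<noteq> level h} \<subseteq> F m" by blast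
    thus "finite {h \<in> carrier G. level (g \<otimes> h) \<noteq> level h}" using fin by (rule finite_subset)
  qed
  hence "finite (level ` carrier G)"
    by (rule tamely_endedD[OF group_axioms one_ended_imp_tamely_ended[OF assms(1)]])
  hence "finite (\<Union>n\<in>level ` carrier G. F n)" using fin by blast
  moreover have "carrier G \<subseteq> (\<Union>n\<in>level ` carrier G. F n)" using level by blast
  ultimately have "finite (carrier G)" using finite_subset by blast
  thus False using assms(1) one_ended_iff by blast
qed

end

section \<open>Groups generated by a one-ended group and finitely many elements\<close>

locale one_ended_subgroup = G: group G + H: group H
  for G :: "('a, 'm) monoid_scheme" and H :: "('b, 'n) monoid_scheme" (structure) +
  fixes \<iota> :: "'b \<Rightarrow> 'a"
  assumes hom: "\<iota> \<in> hom H G" and inj: "inj_on \<iota> (carrier H)"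
    and one_ended: "one_ended H" and countable_H: "countable (carrier H)"
begin

sublocale incl: group_hom H G \<iota>
  using hom by unfold_locales

text \<open>The union of the cosets of \<open>H\<close> in which \<open>A\<close> is cofinite. On an infinite coset where \<open>A\<close> is
finite or cofinite, this is the invariant set closest to \<open>A\<close>.\<close>

definition saturation :: "'a set \<Rightarrow> 'a set" where
  "saturation A = {w \<in> carrier G. finite {h \<in> carrier H. \<iota> h \<otimes>\<^bsub>G\<^esub> w \<notin> A}}"

lemma saturation_invariant_imp:
  assumes k: "k \<in> carrier H" and w: "w \<in> saturation A"
  shows "\<iota> k \<otimes>\<^bsub>G\<^esub> w \<in> saturation A"
proof -
  have wG: "w \<in> carrier G" using w by (simp add: saturation_def)
  let ?E = "{h \<in> carrier H. \<iota> h \<otimes>\<^bsub>G\<^esub> (\<iota> k \<otimes>\<^bsub>G\<^esub> w) \<notin> A}"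
  have "(\<lambda>h. h \<otimes> k) ` ?E \<subseteq> {h \<in> carrier H. \<iota> h \<otimes>\<^bsub>G\<^esub> w \<notin> A}"
    using k wG by (auto simp: G.m_assoc)
  moreover have "finite {h \<in> carrier H. \<iota> h \<otimes>\<^bsub>G\<^esub> w \<notin> A}" using w by (simp add: saturation_def)
  ultimately have "finite ((\<lambda>h. h \<otimes> k) ` ?E)" by (rule finite_subset)
  hence "finite ?E"
    by (rule finite_imageD) (use k in \<open>auto simp: inj_on_def\<close>)
  thus ?thesis using k wG by (simp add: saturation_def)
qed

lemma saturation_invariant:
  assumes k: "k \<in> carrier H" and w: "w \<in> carrier G"
  shows "\<iota> k \<otimes>\<^bsub>G\<^esub> w \<in> saturation A \<longleftrightarrow> w \<in> saturation A"
proof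
  assume "\<iota> k \<otimes>\<^bsub>G\<^esub> w \<in> saturation A"
  hence "\<iota> (inv k) \<otimes>\<^bsub>G\<^esub> (\<iota> k \<otimes>\<^bsub>G\<^esub> w) \<in> saturation A" by (rule saturation_invariant_imp[OF H.inv_closed[OF k]])
  moreover have "\<iota> (inv k) \<otimes>\<^bsub>G\<^esub> (\<iota> k \<otimes>\<^bsub>G\<^esub> w) = w" using k w by (simp flip: G.m_assoc)
  ultimately show "w \<in> saturation A" by (simp only:)
qed (rule saturation_invariant_imp[OF k])

lemma finite_or_cofinite_on_coset:
  assumes A: "left_commensurated G A" and w: "w \<in> carrier G"
  shows "finite {h \<in> carrier H. \<iota> h \<otimes>\<^bsub>G\<^esub> w \<in> A} \<or> finite {h \<in> carrier H. \<iota> h \<otimes>\<^bsub>G\<^esub> w \<notin> A}"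
proof -
  have "left_almost_invariant H ((\<lambda>x. x \<in> A) \<circ> (\<lambda>h. \<iota> h \<otimes>\<^bsub>G\<^esub> w))"
  proof (rule left_almost_invariant_comp)
    show "left_almost_invariant G (\<lambda>x. x \<in> A)"
      using A G.left_commensurated_iff_almost_invariant by blast
    show "inj_on (\<lambda>h. \<iota> h \<otimes>\<^bsub>G\<^esub> w) (carrier H)"
      using inj w by (auto simp: inj_on_def)
  qed (use w in \<open>auto simp: G.m_assoc\<close>)
  hence "left_commensurated H {h \<in> carrier H. \<iota> h \<otimes>\<^bsub>G\<^esub> w \<in> A}"
    using H.left_commensurated_vimage[of "\<lambda>h. \<iota> h \<otimes>\<^bsub>G\<^esub> w \<in> A" "{True}"] by (simp add: o_def)
  moreover have "carrier H - {h \<in> carrier H. \<iota> h \<otimes>\<^bsub>G\<^esub> w \<in> A} = {h \<in> carrier H. \<iota> h \<otimes>\<^bsub>G\<^esub> w \<notin> A}" by blast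
  ultimately show ?thesis using one_ended unfolding H.one_ended_iff by auto
qed

text \<open>Let \<open>w\<close> be a point where \<open>A\<close> and its saturation differ. If \<open>A\<close> were constant on the orbit of \<open>w\<close>
under the infinite subgroup generated by \<open>K\<close>, then infinitely many points of its coset would be exceptional,
which is impossible. So the orbit meets the finite set \<open>B\<close> of jumps, and \<open>w\<close> is one of the
finitely many exceptional points in the coset of some \<open>b \<in> B\<close>.\<close>

lemma finite_sym_diff_saturation:
  assumes A: "left_commensurated G A"
  shows "finite (sym_diff A (saturation A))"
proof -
  obtain K where K: "finite K" "K \<subseteq> carrier H" "infinite (generate H K)"
    using H.one_ended_imp_infinite_finitely_generated_subgroup[OF one_ended countable_H] .
  have AG: "A \<subseteq> carrier G" using A by (simp add: left_commensurated_def)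
  have \<iota>K: "\<iota> ` K \<subseteq> carrier G" using K(2) by auto
  have gen: "generate G (\<iota> ` K) = \<iota> ` generate H K" using K(2) by (rule incl.generate_img)
  define B where "B = G.jumps (\<lambda>x. x \<in> A) (\<iota> ` K)"
  have "finite B"
    unfolding B_def using A G.left_commensurated_iff_almost_invariant K(1) \<iota>K
    by (intro G.finite_jumps) auto
  \<comment> \<open>The exceptional points of the coset of \<open>b\<close>, written as elements of \<open>H\<close>.\<close>
  define E where "E b = {h \<in> carrier H. (\<iota> h \<otimes>\<^bsub>G\<^esub> b \<in> A) \<noteq> (b \<in> saturation A)}" for b
  have finE: "finite (E b)" if "b \<in> carrier G" for b
  proof (cases "b \<in> saturation A")
    case True
    thus ?thesis by (simp add: E_def saturation_def)
  next
    case False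
    thus ?thesis using finite_or_cofinite_on_coset[OF A that] that by (simp add: E_def saturation_def)
  qed
  have "sym_diff A (saturation A) \<subseteq> (\<Union>b\<in>B. (\<lambda>h. \<iota> h \<otimes>\<^bsub>G\<^esub> b) ` E b)"
  proof
    fix w assume w: "w \<in> sym_diff A (saturation A)"
    hence wG: "w \<in> carrier G" using AG by (auto simp: saturation_def)
    have "\<exists>l\<in>generate H K. \<iota> l \<otimes>\<^bsub>G\<^esub> w \<in> B"
    proof (rule ccontr)
      assume no: "\<not> ?thesis"
      have "(\<iota> l \<otimes>\<^bsub>G\<^esub> w \<in> A) = (w \<in> A)" if "l \<in> generate H K" for l
      proof -
        have "\<iota> l \<in> generate G (\<iota> ` K)" using that gen by blast
        from G.constant_on_orbit_or_jump[OF \<iota>K this wG, of "\<lambda>x. x \<in> A"]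
        show ?thesis
        proof
          assume "\<exists>l\<in>generate G (\<iota> ` K). \<exists>k\<in>\<iota> ` K \<union> m_inv G ` \<iota> ` K.
            (k \<otimes>\<^bsub>G\<^esub> (l \<otimes>\<^bsub>G\<^esub> w) \<in> A) \<noteq> (l \<otimes>\<^bsub>G\<^esub> w \<in> A) \<and> (l \<otimes>\<^bsub>G\<^esub> w \<in> A) = (w \<in> A)"
          then obtain l where l: "l \<in> generate G (\<iota> ` K)" "\<exists>k\<in>\<iota> ` K \<union> m_inv G ` \<iota> ` K.
            (k \<otimes>\<^bsub>G\<^esub> (l \<otimes>\<^bsub>G\<^esub> w) \<in> A) \<noteq> (l \<otimes>\<^bsub>G\<^esub> w \<in> A)" by blast
          have "l \<otimes>\<^bsub>G\<^esub> w \<in> B"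
            using l wG G.generate_in_carrier[OF \<iota>K l(1)] by (simp add: B_def G.jumps_def)
          moreover obtain l' where "l' \<in> generate H K" "l = \<iota> l'" using l(1) gen by blast
          ultimately show ?thesis using no by blast
        qed blast
      qed
      hence "generate H K \<subseteq> {h \<in> carrier H. (\<iota> h \<otimes>\<^bsub>G\<^esub> w \<in> A) = (w \<in> A)}"
        using H.generate_in_carrier[OF K(2)] by blast
      moreover have "{h \<in> carrier H. (\<iota> h \<otimes>\<^bsub>G\<^esub> w \<in> A) = (w \<in> A)} = E w"
        using w by (auto simp: E_def)
      ultimately have "generate H K \<subseteq> E w" by simp
      thus False using finE[OF wG] K(3) finite_subset by blast
    qed
    then obtain l where l: "l \<in> generate H K" "\<iota> l \<otimes>\<^bsub>G\<^esub> w \<in> B" by blast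
    have lH: "l \<in> carrier H" using l(1) H.generate_in_carrier[OF K(2)] by blast
    have w': "w = \<iota> (inv l) \<otimes>\<^bsub>G\<^esub> (\<iota> l \<otimes>\<^bsub>G\<^esub> w)" using lH wG by (simp flip: G.m_assoc)
    moreover have "inv l \<in> E (\<iota> l \<otimes>\<^bsub>G\<^esub> w)"
      unfolding E_def using w w' saturation_invariant[OF lH wG] lH by auto
    ultimately show "w \<in> (\<Union>b\<in>B. (\<lambda>h. \<iota> h \<otimes>\<^bsub>G\<^esub> b) ` E b)" using l(2) by blast
  qed
  moreover have "B \<subseteq> carrier G" by (auto simp: B_def G.jumps_def)
  hence "finite (\<Union>b\<in>B. (\<lambda>h. \<iota> h \<otimes>\<^bsub>G\<^esub> b) ` E b)" using \<open>finite B\<close> finE by blast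
  ultimately show ?thesis by (rule finite_subset)
qed

text \<open>Two invariant sets with the same boundary with respect to \<open>T\<close> have a symmetric difference that is
invariant under all generators, so it is empty or everything; membership of the identity decides which.\<close>

theorem countable_ends_algebra:
  assumes "countable (carrier G)" "finite T" "T \<subseteq> carrier G"
    and gen: "generate G (\<iota> ` carrier H \<union> T) = carrier G"
  shows "countable (carrier (ends_algebra G))"
proof -
  define \<I> where "\<I> = {A. left_commensurated G A \<and>
    (\<forall>h\<in>carrier H. \<forall>w\<in>carrier G. (\<iota> h \<otimes>\<^bsub>G\<^esub> w \<in> A) = (w \<in> A))}"
  define boundary where
    "boundary A = (SIGMA t:T. {w \<in> carrier G. (t \<otimes>\<^bsub>G\<^esub> w \<in> A) \<noteq> (w \<in> A)})" for A
  have "carrier (ends_algebra G) \<subseteq> G.end_class ` \<I>"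
  proof
    fix a assume "a \<in> carrier (ends_algebra G)"
    then obtain A where A: "left_commensurated G A" "a = G.end_class A"
      unfolding G.carrier_ends_algebra by blast
    have fin: "finite (sym_diff A (saturation A))" using A(1) by (rule finite_sym_diff_saturation)
    have "sym_diff A (saturation A) \<subseteq> carrier G"
      using A(1) by (auto simp: left_commensurated_def saturation_def)
    hence "left_commensurated G (sym_diff A (sym_diff A (saturation A)))"
      by (intro G.left_commensurated_sym_diff[OF A(1)] G.left_commensurated_finite fin)
    moreover have "sym_diff A (sym_diff A (saturation A)) = saturation A" by blast
    ultimately have lc: "left_commensurated G (saturation A)" by simp
    hence "a = G.end_class (saturation A)" using A fin G.end_class_eq_iff by simp
    moreover have "saturation A \<in> \<I>" using lc saturation_invariant by (simp add: \<I>_def)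
    ultimately show "a \<in> G.end_class ` \<I>" by blast
  qed
  moreover have "countable \<I>"
  proof -
    have inj: "inj_on (\<lambda>A. (\<one>\<^bsub>G\<^esub> \<in> A, boundary A)) \<I>"
    proof (rule inj_onI)
      fix A B assume A: "A \<in> \<I>" and B: "B \<in> \<I>"
        and eq: "(\<one>\<^bsub>G\<^esub> \<in> A, boundary A) = (\<one>\<^bsub>G\<^esub> \<in> B, boundary B)"
      have "((g \<in> A) = (g \<in> B)) = ((\<one>\<^bsub>G\<^esub> \<in> A) = (\<one>\<^bsub>G\<^esub> \<in> B))" if "g \<in> carrier G" for g
      proof (rule G.eq_one_if_invariant)
        show "\<iota> ` carrier H \<union> T \<subseteq> carrier G" using assms(3) by auto
        show "g \<in> generate G (\<iota> ` carrier H \<union> T)" using gen that by simp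
        fix k w assume k: "k \<in> \<iota> ` carrier H \<union> T" and w: "w \<in> carrier G"
        show "((k \<otimes>\<^bsub>G\<^esub> w \<in> A) = (k \<otimes>\<^bsub>G\<^esub> w \<in> B)) = ((w \<in> A) = (w \<in> B))"
        proof (cases "k \<in> T")
          case True
          have "(k, w) \<in> boundary A \<longleftrightarrow> (k, w) \<in> boundary B" using eq by simp
          thus ?thesis using True w by (auto simp: boundary_def)
        next
          case False
          thus ?thesis using A B k w by (auto simp: \<I>_def)
        qed
      qed
      moreover have "(\<one>\<^bsub>G\<^esub> \<in> A) = (\<one>\<^bsub>G\<^esub> \<in> B)" using eq by blast
      ultimately have "g \<in> A \<longleftrightarrow> g \<in> B" if "g \<in> carrier G" for g using that by blast
      moreover have "A \<subseteq> carrier G" "B \<subseteq> carrier G"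
        using A B by (auto simp: \<I>_def left_commensurated_def)
      ultimately show "A = B" by blast
    qed
    have image: "(\<lambda>A. (\<one>\<^bsub>G\<^esub> \<in> A, boundary A)) ` \<I> \<subseteq> UNIV \<times> Fpow (T \<times> carrier G)"
    proof -
      have "finite (boundary A)" if "A \<in> \<I>" for A
        unfolding boundary_def
      proof (intro finite_SigmaI assms(2))
        fix t assume "t \<in> T"
        hence "t \<in> carrier G" using assms(3) by blast
        thus "finite {w \<in> carrier G. (t \<otimes>\<^bsub>G\<^esub> w \<in> A) \<noteq> (w \<in> A)}"
          using that by (simp add: \<I>_def G.left_commensurated_iff_almost_invariant left_almost_invariant_def)
      qed
      thus ?thesis by (auto simp: Fpow_def boundary_def)
    qed
    have "countable ((UNIV :: bool set) \<times> Fpow (T \<times> carrier G))"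
      using assms(1,2) by (intro countable_SIGMA countable_Fpow) (auto intro: countable_finite)
    thus ?thesis by (rule countable_image_inj_on[OF countable_subset[OF image] inj])
  qed
  ultimately show ?thesis by (rule countable_subset[OF _ countable_image])
qed

end

section \<open>Isomorphic copies\<close>

lemma one_ended_iso:
  assumes "group G" "group H" "\<phi> \<in> iso G H" "one_ended H"
  shows "one_ended G"
proof -
  interpret G: group G by fact
  interpret H: group H by fact
  interpret \<phi>: group_hom G H \<phi> using assms(3) by unfold_locales (simp add: iso_def)
  have bij: "bij_betw \<phi> (carrier G) (carrier H)" using assms(3) by (simp add: iso_def)
  define \<psi> where "\<psi> = inv_into (carrier G) \<phi>"
  have \<psi>: "bij_betw \<psi> (carrier H) (carrier G)" unfolding \<psi>_def using bij by (rule bij_betw_inv_into)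
  have hom: "\<psi> \<in> hom H G"
    using G.iso_set_sym[OF assms(3)] unfolding \<psi>_def iso_def by blast
  have "finite A \<or> finite (carrier G - A)" if A: "left_commensurated G A" for A
  proof -
    have AG: "A \<subseteq> carrier G" using A by (simp add: left_commensurated_def)
    have "left_almost_invariant H ((\<lambda>x. x \<in> A) \<circ> \<psi>)"
    proof (rule left_almost_invariant_comp)
      show "left_almost_invariant G (\<lambda>x. x \<in> A)"
        using A G.left_commensurated_iff_almost_invariant by blast
    qed (use hom \<psi> in \<open>auto simp: hom_def bij_betw_def\<close>)
    hence "left_commensurated H {h \<in> carrier H. \<psi> h \<in> A}"
      using H.left_commensurated_vimage[of "\<lambda>h. \<psi> h \<in> A" "{True}"] by (simp add: o_def)
    hence "finite {h \<in> carrier H. \<psi> h \<in> A} \<or> finite (carrier H - {h \<in> carrier H. \<psi> h \<in> A})"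
      using assms(4) H.one_ended_iff by blast
    hence "finite (\<psi> ` {h \<in> carrier H. \<psi> h \<in> A}) \<or> finite (\<psi> ` (carrier H - {h \<in> carrier H. \<psi> h \<in> A}))"
      by (rule disj_forward) (rule finite_imageI, assumption)+
    moreover have "\<psi> ` {h \<in> carrier H. \<psi> h \<in> A} = A"
    proof -
      have "\<psi> ` {h \<in> carrier H. \<psi> h \<in> A} = \<psi> ` carrier H \<inter> A" by blast
      thus ?thesis using AG bij_betw_imp_surj_on[OF \<psi>] by auto
    qed
    moreover have "\<psi> ` (carrier H - {h \<in> carrier H. \<psi> h \<in> A}) = carrier G - A"
    proof -
      have "\<psi> ` (carrier H - {h \<in> carrier H. \<psi> h \<in> A}) = \<psi> ` carrier H - A" by blast
      thus ?thesis using bij_betw_imp_surj_on[OF \<psi>] by simp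
    qed
    ultimately show ?thesis by simp
  qed
  moreover have "infinite (carrier G)"
    using bij_betw_finite[OF bij] assms(4) H.one_ended_iff by blast
  ultimately show ?thesis using G.one_ended_iff by blast
qed

lemma finitely_generated_image:
  assumes "group G" "group H" "\<phi> \<in> hom G H" "\<phi> ` carrier G = carrier H" "finitely_generated G"
  shows "finitely_generated H"
proof -
  interpret G: group G by fact
  interpret H: group H by fact
  interpret \<phi>: group_hom G H \<phi> using assms(3) by unfold_locales
  obtain K where K: "finite K" "K \<subseteq> carrier G" "generate G K = carrier G"
    using assms(5) unfolding finitely_generated_def by blast
  have "generate H (\<phi> ` K) = carrier H" using \<phi>.generate_img[OF K(2)] K(3) assms(4) by simp
  moreover have "finite (\<phi> ` K)" "\<phi> ` K \<subseteq> carrier H" using K by auto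
  ultimately show ?thesis unfolding finitely_generated_def by blast
qed

lemma metrizable_space_of_ends_one_ended:
  assumes "group G" "one_ended G" shows "metrizable_space (space_of_ends G)"
  using assms group.metrizable_space_of_ends_iff[of G] by (simp add: one_ended_def)

lemma nat_copy:
  assumes "group G" "countable (carrier G)"
  obtains N :: "nat monoid" and \<phi> where "group N" "\<phi> \<in> iso N G"
proof -
  interpret group G by fact
  obtain f :: "'a \<Rightarrow> nat" where f: "inj_on f (carrier G)" using assms(2) unfolding countable_def by blast
  have "f \<in> iso G (image_group f G)" using f by (rule inj_imp_image_group_iso)
  hence "inv_into (carrier G) f \<in> iso (image_group f G) G" by (rule iso_set_sym)
  thus thesis using that inj_imp_image_group_is_group[OF f] by blast
qed

section \<open>Free groups\<close>

text \<open>Prepending a letter \<open>x\<close> to a reduced word changes its last letter only if the word is empty or is the single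
letter inverse to \<open>x\<close>. So each letter of \<open>g\<close> accounts for at most two exceptional \<open>w\<close>.\<close>

lemma almost_invariant_last_generator:
  fixes S :: "'b set"
  shows "left_almost_invariant (free_group S) (\<lambda>w. if w = [] then None else Some (fst (last w)))"
    (is "left_almost_invariant _ ?f")
proof -
  let ?F = "free_group S"
  interpret group ?F by (rule group_free_group)
  have mult: "u \<otimes>\<^bsub>?F\<^esub> v = foldr free_cons u v" for u v by (simp add: free_group_def)
  have "finite {w \<in> carrier ?F. ?f (g \<otimes>\<^bsub>?F\<^esub> w) \<noteq> ?f w}" if "g \<in> carrier ?F" for g
    using that
  proof (induction g)
    case Nil
    thus ?case by (simp add: mult)
  next
    case (Cons x g)
    have g: "g \<in> carrier ?F" using Cons.prems by (cases g) (auto simp: free_group_def)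
    \<comment> \<open>The words whose last letter is affected when \<open>x\<close> is prepended.\<close>
    let ?B = "{[], [(fst x, \<not> snd x)]}"
    have stable: "?f (free_cons x u) = ?f u" if "u \<notin> ?B" for u
      using that by (cases u; cases "tl u") (auto simp: free_cons_def)
    have "{w \<in> carrier ?F. ?f ((x # g) \<otimes>\<^bsub>?F\<^esub> w) \<noteq> ?f w} \<subseteq>
        {w \<in> carrier ?F. ?f (g \<otimes>\<^bsub>?F\<^esub> w) \<noteq> ?f w} \<union> {w \<in> carrier ?F. g \<otimes>\<^bsub>?F\<^esub> w \<in> ?B}"
    proof
      fix w assume "w \<in> {w \<in> carrier ?F. ?f ((x # g) \<otimes>\<^bsub>?F\<^esub> w) \<noteq> ?f w}"
      hence w: "w \<in> carrier ?F" "?f ((x # g) \<otimes>\<^bsub>?F\<^esub> w) \<noteq> ?f w" by simp_all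
      have step: "(x # g) \<otimes>\<^bsub>?F\<^esub> w = free_cons x (g \<otimes>\<^bsub>?F\<^esub> w)" by (simp add: mult)
      show "w \<in> {w \<in> carrier ?F. ?f (g \<otimes>\<^bsub>?F\<^esub> w) \<noteq> ?f w} \<union> {w \<in> carrier ?F. g \<otimes>\<^bsub>?F\<^esub> w \<in> ?B}"
      proof (cases "g \<otimes>\<^bsub>?F\<^esub> w \<in> ?B")
        case False
        hence "?f (g \<otimes>\<^bsub>?F\<^esub> w) \<noteq> ?f w" using w(2) stable[OF False] unfolding step by argo
        thus ?thesis using w(1) by blast
      qed (use w(1) in blast)
    qed
    moreover have "finite {w \<in> carrier ?F. g \<otimes>\<^bsub>?F\<^esub> w \<in> ?B}"
    proof -
      have "inj_on (\<lambda>w. g \<otimes>\<^bsub>?F\<^esub> w) (carrier ?F)" using g by (rule inj_on_cmult)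
      hence "finite ((\<lambda>w. g \<otimes>\<^bsub>?F\<^esub> w) -` ?B \<inter> carrier ?F)" by (intro finite_vimage_IntI) auto
      moreover have "{w \<in> carrier ?F. g \<otimes>\<^bsub>?F\<^esub> w \<in> ?B} = (\<lambda>w. g \<otimes>\<^bsub>?F\<^esub> w) -` ?B \<inter> carrier ?F" by blast
      ultimately show ?thesis by simp
    qed
    ultimately show ?case using Cons.IH[OF g] by (meson finite_UnI finite_subset)
  qed
  thus ?thesis unfolding left_almost_invariant_def by blast
qed

theorem free_group_not_tamely_ended:
  assumes "group F" "infinite S" "F \<cong> free_group S"
  shows "\<not> tamely_ended F"
proof
  assume tame: "tamely_ended F"
  let ?f = "\<lambda>w. if w = [] then None else Some (fst (last w))"
  obtain \<phi> where \<phi>: "\<phi> \<in> iso F (free_group S)" using assms(3) unfolding is_iso_def by blast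
  have "left_almost_invariant F (?f \<circ> \<phi>)"
    by (rule left_almost_invariant_comp[OF almost_invariant_last_generator])
      (use \<phi> in \<open>auto simp: iso_def hom_def bij_betw_def\<close>)
  hence "finite ((?f \<circ> \<phi>) ` carrier F)" using tamely_endedD[OF assms(1) tame] by blast
  moreover have "(?f \<circ> \<phi>) ` carrier F = ?f ` carrier (free_group S)"
  proof -
    have "\<phi> ` carrier F = carrier (free_group S)" using \<phi> by (simp add: iso_def bij_betw_def)
    thus ?thesis by (simp only: image_comp [symmetric])
  qed
  moreover have "Some ` S \<subseteq> ?f ` carrier (free_group S)"
  proof
    fix y assume "y \<in> Some ` S"
    then obtain s where s: "s \<in> S" "y = Some s" by blast
    have "[(s, True)] \<in> carrier (free_group S)" using s by (simp add: free_group_def)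
    thus "y \<in> ?f ` carrier (free_group S)" using s by force
  qed
  ultimately have "finite (Some ` S)" by (simp only:) (rule finite_subset)
  thus False using assms(2) finite_imageD[of Some S] by auto
qed

corollary free_group_not_metrizable:
  assumes "group F" "infinite S" "F \<cong> free_group S"
  shows "\<not> metrizable_space (space_of_ends F)"
  using free_group_not_tamely_ended[OF assms] group.tamely_ended_if_metrizable[OF assms(1)] by blast

section \<open>The rationals\<close>

lemma group_rational_group: "group rational_group"
  by (rule groupI) (auto simp: rational_group_def intro: exI[of _ "- _"])

lemma rational_group_simps [simp]:
  "carrier rational_group = UNIV" "x \<otimes>\<^bsub>rational_group\<^esub> y = x + y" "\<one>\<^bsub>rational_group\<^esub> = 0"
  by (auto simp: rational_group_def)

lemma inv_rational_group [simp]: "inv\<^bsub>rational_group\<^esub> x = - x"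
  by (rule group.inv_equality[OF group_rational_group]) auto

text \<open>Cosets of the integers are compared in two ways. Any two of them meet \<open>A\<close> in almost the same way, since
\<open>A\<close> is almost invariant under translation by \<open>y - x\<close> (\<open>parallel\<close>). And a coset that avoids the finite
set \<open>D\<close> lies inside or outside \<open>A\<close> (\<open>const\<close>); as there are infinitely many cosets, one such exists, that of
\<open>r\<close>. So every coset has only finitely many exceptional points and, by \<open>const\<close> again,
only the finitely many cosets that meet \<open>D\<close> have any.\<close>

theorem one_ended_rational_group: "one_ended rational_group"
proof -
  interpret group rational_group by (rule group_rational_group)
  have "finite A \<or> finite (- A)" if lc: "left_commensurated rational_group A" for A
  proof -
    have fin: "finite {x. (q + x \<in> A) \<noteq> (x \<in> A)}" for q
      using lc unfolding left_commensurated_iff_almost_invariant left_almost_invariant_def by simp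
    define D where "D = {x. (1 + x \<in> A) \<noteq> (x \<in> A)}"
    have parallel: "finite {k::int. (y + of_int k \<in> A) \<noteq> (x + of_int k \<in> A)}" for x y
    proof -
      have "(\<lambda>k::int. x + of_int k) ` {k. (y + of_int k \<in> A) \<noteq> (x + of_int k \<in> A)}
          \<subseteq> {z. ((y - x) + z \<in> A) \<noteq> (z \<in> A)}" by (auto simp: algebra_simps)
      hence "finite ((\<lambda>k::int. x + of_int k) ` {k. (y + of_int k \<in> A) \<noteq> (x + of_int k \<in> A)})"
        using fin finite_subset by blast
      thus ?thesis by (rule finite_imageD) (auto simp: inj_on_def)
    qed
    have const: "x + of_int k \<in> A \<longleftrightarrow> x \<in> A" if "\<And>k::int. x + of_int k \<notin> D" for x and k :: int
    proof (induction k rule: int_induct[where k = 0])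
      case (step1 i)
      thus ?case using that[of i] by (auto simp: D_def algebra_simps)
    next
      case (step2 i)
      thus ?case using that[of "i - 1"] by (auto simp: D_def algebra_simps)
    qed simp
    have "infinite {0::rat<..<1}" by (simp add: infinite_Ioo)
    moreover have "finite (frac ` D)" unfolding D_def by (intro finite_imageI fin)
    \<comment> \<open>Choosing \<open>r\<close> in the unit interval makes it its own fractional part.\<close>
    ultimately obtain r where r: "r \<in> {0<..<1}" "r \<notin> frac ` D"
      by (meson finite_subset subsetI)
    have "r + of_int k \<notin> D" for k :: int
    proof
      assume "r + of_int k \<in> D"
      moreover have "frac (r + of_int k) = r" using r(1) by (simp add: frac_unique_iff)
      ultimately show False using r(2) by (metis imageI)
    qed
    hence r_const: "r + of_int k \<in> A \<longleftrightarrow> r \<in> A" for k :: int by (rule const)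
    have bounded: "finite {k::int. (x + of_int k \<in> A) \<noteq> (r \<in> A)}" for x
      using parallel[of x r] by (simp add: r_const)
    have "{x. (x \<in> A) \<noteq> (r \<in> A)} \<subseteq>
        (\<Union>d\<in>D. (\<lambda>k. d + of_int k) ` {k::int. (d + of_int k \<in> A) \<noteq> (r \<in> A)})"
    proof
      fix x assume x: "x \<in> {x. (x \<in> A) \<noteq> (r \<in> A)}"
      obtain k :: int where k: "x + of_int k \<in> D"
      proof (rule ccontr)
        assume "\<not> thesis"
        hence "x + of_int k \<in> A \<longleftrightarrow> x \<in> A" for k :: int using const that by blast
        hence "{k::int. (x + of_int k \<in> A) \<noteq> (r \<in> A)} = UNIV" using x by auto
        thus False using bounded[of x] by simp
      qed
      have "x = (x + of_int k) + of_int (- k)" by simp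
      thus "x \<in> (\<Union>d\<in>D. (\<lambda>k. d + of_int k) ` {k::int. (d + of_int k \<in> A) \<noteq> (r \<in> A)})"
        using k x by (intro UN_I[OF k] image_eqI[of _ _ "- k"]) auto
    qed
    moreover have "finite (\<Union>d\<in>D. (\<lambda>k. d + of_int k) ` {k::int. (d + of_int k \<in> A) \<noteq> (r \<in> A)})"
      unfolding D_def using bounded fin by (intro finite_UN_I finite_imageI) auto
    ultimately have "finite {x. (x \<in> A) \<noteq> (r \<in> A)}" by (rule finite_subset)
    thus ?thesis by (cases "r \<in> A") (auto simp: Compl_eq)
  qed
  thus ?thesis unfolding one_ended_iff by (simp add: infinite_UNIV_char_0 Compl_eq_Diff_UNIV)
qed

lemma common_denominator:
  fixes S :: "rat set"
  assumes "finite S"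
  shows "\<exists>n::nat. n > 0 \<and> (\<forall>s\<in>S. of_nat n * s \<in> \<int>)"
  using assms
proof induction
  case (insert s S)
  then obtain n where n: "n > 0" "\<forall>s\<in>S. of_nat n * s \<in> \<int>" by blast
  obtain a b where s: "s = of_int a / of_int b" "b > 0" by (cases s) (auto simp: Fract_of_int_quotient)
  have "of_nat (n * nat b) * s = of_nat n * of_int a" using s by simp
  moreover have "of_nat (n * nat b) * t = of_nat (nat b) * (of_nat n * t)" for t :: rat by simp
  ultimately have "\<forall>t\<in>insert s S. of_nat (n * nat b) * t \<in> \<int>"
    using n by (metis Ints_mult Ints_of_int Ints_of_nat insert_iff)
  moreover have "n * nat b > 0" using n s by simp
  ultimately show ?case by blast
qed auto

lemma rational_group_not_finitely_generated: "\<not> finitely_generated rational_group"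
proof
  assume "finitely_generated rational_group"
  then obtain S where S: "finite S" "generate rational_group S = UNIV"
    unfolding finitely_generated_def by auto
  obtain n :: nat where n: "n > 0" "\<forall>s\<in>S. of_nat n * s \<in> \<int>" using common_denominator[OF S(1)] by blast
  have "of_nat n * q \<in> \<int>" if "q \<in> generate rational_group S" for q
    using that by induction (use n in \<open>auto simp: distrib_left\<close>)
  hence "of_nat n * (1 / (2 * of_nat n)) \<in> (\<int> :: rat set)" using S(2) by blast
  hence "1 / 2 \<in> (\<int> :: rat set)" using n(1) by simp
  then obtain k :: int where "1 / 2 = (of_int k :: rat)" by (elim Ints_cases)
  hence "of_int (2 * k) = (1 :: rat)" by simp
  hence "2 * k = 1" by (simp only: of_int_eq_1_iff)
  thus False by presburger
qed

section \<open>Free products\<close>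

text \<open>The embeddings of the factors: a reduced word does not contain the letter \<open>\<one>\<close>, so the identity goes to the empty word.\<close>

definition left_word :: "('a, 'm) monoid_scheme \<Rightarrow> 'a \<Rightarrow> ('a + 'b) list" where
  "left_word G a = (if a = \<one>\<^bsub>G\<^esub> then [] else [Inl a])"

definition right_word :: "('b, 'n) monoid_scheme \<Rightarrow> 'b \<Rightarrow> ('a + 'b) list" where
  "right_word H b = (if b = \<one>\<^bsub>H\<^esub> then [] else [Inr b])"

lemma left_word_hom: "group G \<Longrightarrow> left_word G \<in> hom G (free_product G H)"
  by (rule homI) (auto simp: left_word_def free_product_def product_cons_def group.is_monoid monoid.m_closed
      monoid.l_one monoid.r_one)

lemma right_word_hom: "group H \<Longrightarrow> right_word H \<in> hom H (free_product G H)"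
  by (rule homI) (auto simp: right_word_def free_product_def product_cons_def group.is_monoid monoid.m_closed
      monoid.l_one monoid.r_one)

lemma generate_free_product:
  assumes "group G" "group H"
  shows "generate (free_product G H) (left_word G ` carrier G \<union> right_word H ` carrier H) = carrier (free_product G H)"
    (is "generate ?P ?K = _")
proof
  interpret P: group ?P using assms by (rule group_free_product)
  have K: "?K \<subseteq> carrier ?P"
    using left_word_hom[OF assms(1), of H] right_word_hom[OF assms(2), of G] unfolding hom_def by auto
  show "generate ?P ?K \<subseteq> carrier ?P" using P.generate_in_carrier[OF K] by blast
  show "carrier ?P \<subseteq> generate ?P ?K"
  proof
    fix w assume "w \<in> carrier ?P"
    thus "w \<in> generate ?P ?K"
    proof (induction w)
      case Nil
      thus ?case using generate.one[of ?P ?K] by (simp add: free_product_def)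
    next
      case (Cons x w)
      have w: "w \<in> carrier ?P" using Cons.prems by (cases w) (auto simp: free_product_def)
      have "[x] \<in> ?K"
      proof (cases x)
        case (Inl a)
        hence "a \<in> carrier G" "left_word G a = [x]"
          using Cons.prems by (auto simp: free_product_def left_word_def)
        thus ?thesis by (metis UnI1 imageI)
      next
        case (Inr b)
        hence "b \<in> carrier H" "right_word H b = [x]"
          using Cons.prems by (auto simp: free_product_def right_word_def)
        thus ?thesis by (metis UnI2 imageI)
      qed
      moreover have "[x] \<otimes>\<^bsub>?P\<^esub> w = x # w"
        using Cons.prems by (cases x; cases w; cases "hd w") (auto simp: free_product_def product_cons_def)
      ultimately show ?case using generate.eng[OF generate.incl Cons.IH[OF w]] by metis
    qed
  qed
qed

lemma countable_free_product:
  assumes "countable (carrier G)" "countable (carrier H)"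
  shows "countable (carrier (free_product G H))"
proof -
  have "carrier (free_product G H) \<subseteq> lists (carrier G <+> carrier H)"
    by (auto simp: free_product_def lists_eq_set)
  moreover have "countable (lists (carrier G <+> carrier H))" using assms by (intro countable_lists countable_Plus)
  ultimately show ?thesis by (rule countable_subset)
qed

theorem metrizable_space_of_ends_free_product:
  assumes "group H" "countable (carrier H)" "one_ended H"
  shows "metrizable_space (space_of_ends (free_product H integer_group))"
proof -
  let ?P = "free_product H integer_group"
  interpret P: group ?P using assms(1) by (intro group_free_product) auto
  interpret one_ended_subgroup ?P H "left_word H"
  proof (intro one_ended_subgroup.intro one_ended_subgroup_axioms.intro)
    show "inj_on (left_word H) (carrier H)" by (auto simp: inj_on_def left_word_def split: if_splits)
  qed (use assms left_word_hom P.group_axioms in auto)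
  interpret Z: group_hom integer_group ?P "right_word integer_group"
    by (intro group_hom.intro group_hom_axioms.intro right_word_hom P.group_axioms) auto
  let ?t = "right_word integer_group (1::int)"
  let ?K = "left_word H ` carrier H \<union> {?t}"
  have K: "?K \<subseteq> carrier ?P" using hom Z.hom_closed[of 1] unfolding hom_def by auto
  have "generate integer_group {1} = UNIV"
    using group.generate_pow[OF group_integer_group, of 1] by simp
  hence "right_word integer_group ` UNIV = generate ?P {?t}"
    using Z.generate_img[of "{1}"] by simp
  moreover have "generate ?P {?t} \<subseteq> generate ?P ?K" by (rule P.mono_generate) auto
  ultimately have "left_word H ` carrier H \<union> right_word integer_group ` carrier integer_group \<subseteq> generate ?P ?K"
    using generate.incl[of _ ?K ?P] by auto
  hence "generate ?P (left_word H ` carrier H \<union> right_word integer_group ` carrier integer_group) \<subseteq> generate ?P ?K"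
    by (rule P.generate_subgroup_incl[OF _ P.generate_is_subgroup[OF K]])
  hence "generate ?P ?K = carrier ?P"
    using generate_free_product[OF assms(1) group_integer_group] P.generate_in_carrier[OF K] by blast
  hence "countable (carrier (ends_algebra ?P))"
    using countable_free_product[OF assms(2), of integer_group] K
    by (intro countable_ends_algebra[of "{?t}"]) auto
  thus ?thesis using P.metrizable_space_of_ends_iff by blast
qed

section \<open>Metrizable and non-metrizable spaces of ends\<close>

theorem theorem1p13:
  shows
    "(\<exists>G::nat monoid. group G \<and> countable (carrier G) \<and> \<not> finitely_generated G \<and>
        metrizable_space (space_of_ends G)) \<and>
     (\<exists>G::nat monoid. group G \<and> countable (carrier G) \<and> \<not> finitely_generated G \<and>
        \<not> metrizable_space (space_of_ends G)) \<and>
     (\<forall>(F::'a monoid) (S::'b set). group F \<and> infinite S \<and> F \<cong> free_group S \<longrightarrow>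
        \<not> metrizable_space (space_of_ends F) \<and> \<not> tamely_ended F) \<and>
     (\<forall>H::'c monoid. group H \<and> countable (carrier H) \<and> one_ended H \<longrightarrow>
        metrizable_space (space_of_ends (free_product H integer_group))) \<and>
     metrizable_space (space_of_ends (free_product rational_group integer_group))"
proof (intro conjI allI impI)
  obtain N :: "nat monoid" and \<phi> where N: "group N" and \<phi>: "\<phi> \<in> iso N rational_group"
    using nat_copy[OF group_rational_group] by auto
  have "metrizable_space (space_of_ends N)"
    using metrizable_space_of_ends_one_ended[OF N]
      one_ended_iso[OF N group_rational_group \<phi> one_ended_rational_group] by blast
  moreover have "\<not> finitely_generated N"
    using finitely_generated_image[OF N group_rational_group, of \<phi>] \<phi>
      rational_group_not_finitely_generated by (auto simp: iso_def bij_betw_def)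
  ultimately show "\<exists>G::nat monoid. group G \<and> countable (carrier G) \<and> \<not> finitely_generated G \<and>
        metrizable_space (space_of_ends G)" using N by blast
next
  let ?F = "free_group (UNIV :: nat set)"
  obtain N :: "nat monoid" and \<phi> where N: "group N" and \<phi>: "\<phi> \<in> iso N ?F"
    using nat_copy[OF group_free_group countableI_type, of UNIV] by blast
  have iso: "N \<cong> ?F" using \<phi> unfolding is_iso_def by blast
  have "\<not> metrizable_space (space_of_ends N)"
    using free_group_not_metrizable[OF N _ iso] by simp
  moreover have "\<not> finitely_generated N"
    using free_group_not_tamely_ended[OF N _ iso] group.finitely_generated_imp_tamely_ended[OF N] by auto
  ultimately show "\<exists>G::nat monoid. group G \<and> countable (carrier G) \<and> \<not> finitely_generated G \<and>
        \<not> metrizable_space (space_of_ends G)" using N by blast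
next
  fix F :: "'a monoid" and S :: "'b set"
  assume "group F \<and> infinite S \<and> F \<cong> free_group S"
  thus "\<not> metrizable_space (space_of_ends F)" "\<not> tamely_ended F"
    using free_group_not_metrizable free_group_not_tamely_ended by blast+
next
  fix H :: "'c monoid"
  assume "group H \<and> countable (carrier H) \<and> one_ended H"
  thus "metrizable_space (space_of_ends (free_product H integer_group))"
    using metrizable_space_of_ends_free_product by blast
next
  show "metrizable_space (space_of_ends (free_product rational_group integer_group))"
    by (intro metrizable_space_of_ends_free_product group_rational_group one_ended_rational_group) auto
qed

end
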